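(* Let $H$ be an infinite dimensional complex Hilbert space and let $T\in\mathcal{B}(H)$. Then the following are equivalent: (1) $T\in\mathcal{AM}^+(H)$, i.e. $T$ is positive and absolutely minimum attaining; (2) there exists a decomposition of $T$ of the form $T=\alpha I-K+F$, where $\alpha\ge 0$ is a real scalar, $K\in\mathcal{B}(H)$ is a positive compact operator with $\|K\|\le\alpha$, and $F\in\mathcal{B}(H)$ is a positive finite rank operator satisfying $KF=FK=0$. Moreover, this decomposition is unique: the triple $(\alpha,K,F)$ with these properties is uniquely determined by $T$.
   Context: $\mathcal{B}(H)$ is the space of bounded linear operators on $H$ ($H$ is not assumed separable). $T\in\mathcal{B}(H)$ is positive ($T\ge 0$) if $T=T^*$ and $\langle Tx,x\rangle\ge 0$ for all $x\in H$ (so the zero operator is positive). For a bounded operator $T:H_1\to H_2$ between complex Hilbert spaces, the minimum modulus is $m(T)=\inf\{\|Tx\|: x\in H_1,\ \|x\|=1\}$; $T$ is minimum attaining if there is $x_0\in H_1$ with $\|x_0\|=1$ and $\|Tx_0\|=m(T)$; $T$ is absolutely minimum attaining if the restriction $T|_M:M\to H_2$ is minimum attaining for every nonzero closed subspace $M$ of $H_1$. $\mathcal{AM}(H)$ is the set of absolutely minimum attaining $T\in\mathcal{B}(H)$, and $\mathcal{AM}^+(H)=\{T\in\mathcal{AM}(H):T\ge 0\}$. $I$ is the identity operator. *)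

theory Defs
  imports "HOL-Analysis.Analysis" "HOL-Library.Nonpos_Ints"
begin

section \<open>Complex Hilbert spaces\<close>

class complex_vector = real_vector +
  fixes scaleC :: "complex \<Rightarrow> 'a \<Rightarrow> 'a"  (infixr "*\<^sub>C" 75)
  assumes scaleC_add_right: "c *\<^sub>C (x + y) = c *\<^sub>C x + c *\<^sub>C y"
    and scaleC_add_left: "(c + d) *\<^sub>C x = c *\<^sub>C x + d *\<^sub>C x"
    and scaleC_scaleC: "c *\<^sub>C d *\<^sub>C x = (c * d) *\<^sub>C x"
    and scaleC_one: "1 *\<^sub>C x = x"
    and scaleR_scaleC: "r *\<^sub>R x = complex_of_real r *\<^sub>C x"

global_interpretation complex_vector: vector_space "scaleC :: complex \<Rightarrow> 'a \<Rightarrow> 'a::complex_vector"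
  defines csubspace = complex_vector.subspace
    and cspan = complex_vector.span
  by unfold_locales (simp_all add: scaleC_add_right scaleC_add_left scaleC_scaleC scaleC_one)

text \<open>The complex inner product is linear in its first argument. The real inner product of
  \<^class>\<open>real_inner\<close> is its real part, so the norm is the one induced by \<open>cinner\<close>:
  \<open>cinner x x\<close> is real by symmetry and its real part is \<open>inner x x = (norm x)\<^sup>2\<close>. In particular
  positive definiteness is inherited from \<^class>\<open>real_inner\<close>.\<close>

class complex_inner = complex_vector + real_inner +
  fixes cinner :: "'a \<Rightarrow> 'a \<Rightarrow> complex"
  assumes cinner_commute: "cinner x y = cnj (cinner y x)"
    and cinner_add_left: "cinner (x + y) z = cinner x z + cinner y z"
    and cinner_scaleC_left: "cinner (c *\<^sub>C x) y = c * cinner x y"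
    and Re_cinner: "Re (cinner x y) = inner x y"

class chilbert_space = complex_inner + complete_space

lemma cinner_self: "cinner x x = complex_of_real ((norm x)\<^sup>2)"
proof (rule complex_eqI)
  show "Im (cinner x x) = Im (complex_of_real ((norm x)\<^sup>2))"
    using arg_cong[OF cinner_commute[of x x], of Im] by simp
qed (simp add: Re_cinner power2_norm_eq_inner)

definition cfinite_dim :: "'a::complex_vector set \<Rightarrow> bool" where
  "cfinite_dim V \<longleftrightarrow> (\<exists>B. finite B \<and> cspan B = V)"


section \<open>Bounded operators\<close>

definition bounded_clinear :: "('a::complex_inner \<Rightarrow> 'b::complex_inner) \<Rightarrow> bool" where
  "bounded_clinear T \<longleftrightarrow> bounded_linear T \<and> (\<forall>c x. T (c *\<^sub>C x) = c *\<^sub>C T x)"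

text \<open>For a bounded operator on a Hilbert space the Riesz representation theorem guarantees that
  the adjoint exists.\<close>

definition cadjoint :: "('a::complex_inner \<Rightarrow> 'b::complex_inner) \<Rightarrow> 'b \<Rightarrow> 'a" where
  "cadjoint T = (THE S. \<forall>x y. cinner (T x) y = cinner x (S y))"

lemma cadjoint_eqI:
  assumes S: "\<And>x y. cinner (T x) y = cinner x (S y)"
  shows "cadjoint T = S"
  unfolding cadjoint_def
proof (rule the_equality)
  fix S' assume S': "\<forall>x y. cinner (T x) y = cinner x (S' y)"
  show "S' = S"
  proof
    fix y
    have "inner x (S' y) = inner x (S y)" for x
      using S S' by (metis Re_cinner)
    then show "S' y = S y"
      by (metis inner_commute vector_eq_rdot)
  qed
qed (use S in simp)

definition positive_op :: "('a::complex_inner \<Rightarrow> 'a) \<Rightarrow> bool" where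
  "positive_op T \<longleftrightarrow> T = cadjoint T \<and> (\<forall>x. cinner (T x) x \<in> \<real>\<^sub>\<ge>\<^sub>0)"

definition compact_op :: "('a::complex_inner \<Rightarrow> 'b::complex_inner) \<Rightarrow> bool" where
  "compact_op T \<longleftrightarrow> bounded_clinear T \<and> compact (closure (T ` cball 0 1))"

definition finite_rank_op :: "('a::complex_inner \<Rightarrow> 'b::complex_inner) \<Rightarrow> bool" where
  "finite_rank_op T \<longleftrightarrow> bounded_clinear T \<and> cfinite_dim (range T)"


section \<open>Absolutely minimum attaining operators\<close>

text \<open>Restrictions \<open>T|\<^sub>M\<close> are expressed by relativising to a subspace \<open>M\<close>; the unrestricted
  notions are the case \<open>M = UNIV\<close>.\<close>

definition min_modulus_on ::
    "'a::complex_inner set \<Rightarrow> ('a \<Rightarrow> 'b::complex_inner) \<Rightarrow> real" where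
  "min_modulus_on M T = Inf {norm (T x) | x. x \<in> M \<and> norm x = 1}"

definition min_attaining_on ::
    "'a::complex_inner set \<Rightarrow> ('a \<Rightarrow> 'b::complex_inner) \<Rightarrow> bool" where
  "min_attaining_on M T \<longleftrightarrow> (\<exists>x\<^sub>0\<in>M. norm x\<^sub>0 = 1 \<and> norm (T x\<^sub>0) = min_modulus_on M T)"

definition abs_min_attaining :: "('a::complex_inner \<Rightarrow> 'b::complex_inner) \<Rightarrow> bool" where
  "abs_min_attaining T \<longleftrightarrow>
    (\<forall>M. csubspace M \<and> closed M \<and> M \<noteq> {0} \<longrightarrow> min_attaining_on M T)"

definition AM_ops :: "('a::chilbert_space \<Rightarrow> 'a) set" where
  "AM_ops = {T. bounded_clinear T \<and> abs_min_attaining T}"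

definition AM_pos_ops :: "('a::chilbert_space \<Rightarrow> 'a) set" where
  "AM_pos_ops = {T \<in> AM_ops. positive_op T}"

definition AM_decomposition ::
    "('a::chilbert_space \<Rightarrow> 'a) \<Rightarrow> real \<Rightarrow> ('a \<Rightarrow> 'a) \<Rightarrow> ('a \<Rightarrow> 'a) \<Rightarrow> bool" where
  "AM_decomposition T \<alpha> K F \<longleftrightarrow>
     \<alpha> \<ge> 0 \<and>
     bounded_clinear K \<and> positive_op K \<and> compact_op K \<and> onorm K \<le> \<alpha> \<and>
     bounded_clinear F \<and> positive_op F \<and> finite_rank_op F \<and>
     K \<circ> F = (\<lambda>x. 0) \<and> F \<circ> K = (\<lambda>x. 0) \<and>
     T = (\<lambda>x. \<alpha> *\<^sub>R x - K x + F x)"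

end

theory Submission
  imports Defs
begin

text \<open>For a decomposition \<open>T = \<alpha> I - K + F\<close> one has
  \<open>\<parallel>T z\<parallel>\<^sup>2 \<ge> \<alpha>\<^sup>2 \<parallel>z\<parallel>\<^sup>2 - 2 \<alpha> \<parallel>K z\<parallel> \<parallel>z\<parallel>\<close>. If the infimum on \<open>M\<close> is below \<open>\<alpha>\<close>, minimizing
  sequences therefore have convergent subsequences; otherwise a unit vector of \<open>M\<close> in the kernel of
  \<open>F\<close> is a minimizer, or \<open>F\<close> is injective on \<open>M\<close> and \<open>M\<close> is finite dimensional.
  Conversely, the minimizers on invariant subspaces are eigenvectors, so an absolutely minimum
  attaining positive operator has an orthonormal eigenbasis, and its eigenvalues have exactly one
  cluster value \<open>\<alpha>\<close>, which is not approached from above; \<open>K\<close> and \<open>F\<close> are the parts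
  of \<open>T\<close> below and above \<open>\<alpha>\<close>. Uniqueness of \<open>\<alpha>\<close> holds because the unit ball is not
  compact, and \<open>K\<close>, \<open>F\<close> are then the positive and negative parts of \<open>\<alpha> I - T\<close>.\<close>

section \<open>Inner products and orthonormal sets\<close>

text \<open>The recurring device is Cauchy-Schwarz for a form that is nonnegative on a subspace:
  \<open>norm_sq_le_form\<close> bounds \<open>norm (S x)\<close> through the form of
  \<open>S\<close> at \<open>x\<close>. With S = T^2 - m^2 it turns minimizers into eigenvectors,
  with S = d I - D it produces the approximate eigenvectors of the uniqueness proof, and with S = K
  it bounds T by \<alpha> on the kernel of F. The space may be nonseparable, so eigenbases are
  maximal orthonormal sets, and vectors are never expanded into infinite sums: an estimate is
  checked by Pythagoras on finite combinations and, being a closed condition, passes to the closure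
  of the span. Infinite dimension enters twice: infinitely many eigenvectors force a cluster value
  \<alpha>, and noncompactness of the ball fixes \<alpha>. Counted with multiplicity, only finitely
  many eigenvalues exceed \<alpha>, so F has finite rank, and only finitely many lie below \<alpha>
  - \<epsilon>, so K is a norm limit of finite rank operators.\<close>

lemma cinner_add_right: "cinner x (y + z) = cinner x y + cinner x z"
  by (simp add: cinner_commute[of x] cinner_add_left)

lemma cinner_scaleC_right: "cinner x (c *\<^sub>C y) = cnj c * cinner x y"
  by (simp add: cinner_commute[of x] cinner_scaleC_left)

lemma cinner_zero_left [simp]: "cinner 0 y = 0"
  using cinner_add_left[of 0 0 y] by simp

lemma cinner_zero_right [simp]: "cinner x 0 = 0"
  using cinner_add_right[of x 0 0] by simp

lemma cinner_scaleR_left: "cinner (r *\<^sub>R x) y = of_real r * cinner x y"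
  by (simp add: scaleR_scaleC cinner_scaleC_left)

lemma cinner_scaleR_right: "cinner x (r *\<^sub>R y) = of_real r * cinner x y"
  by (simp add: scaleR_scaleC cinner_scaleC_right)

lemma cinner_minus_left: "cinner (- x) y = - cinner x y"
  using cinner_scaleR_left[of "-1" x y] by simp

lemma cinner_minus_right: "cinner x (- y) = - cinner x y"
  using cinner_scaleR_right[of x "-1" y] by simp

lemma cinner_diff_left: "cinner (x - y) z = cinner x z - cinner y z"
  using cinner_add_left[of x "- y" z] by (simp add: cinner_minus_left)

lemma cinner_diff_right: "cinner x (y - z) = cinner x y - cinner x z"
  using cinner_add_right[of x y "- z"] by (simp add: cinner_minus_right)

lemma cinner_sum_left: "cinner (sum f A) y = (\<Sum>a\<in>A. cinner (f a) y)"
  by (induction A rule: infinite_finite_induct) (simp_all add: cinner_add_left)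

lemma cinner_sum_right: "cinner x (sum f A) = (\<Sum>a\<in>A. cinner x (f a))"
  by (induction A rule: infinite_finite_induct) (simp_all add: cinner_add_right)

lemma cinner_eq_0_commute: "cinner x y = 0 \<longleftrightarrow> cinner y x = 0"
  by (simp add: cinner_commute[of x])

lemma cinner_eq_0_imp_orthogonal: "cinner x y = 0 \<Longrightarrow> orthogonal x y"
  by (simp add: orthogonal_def Re_cinner[symmetric])

lemma norm_scaleC: "norm (c *\<^sub>C x) = cmod c * norm (x::'a::complex_inner)"
proof -
  have "complex_of_real ((norm (c *\<^sub>C x))\<^sup>2) = (c * cnj c) * cinner x x"
    by (simp only: cinner_self[symmetric] cinner_scaleC_left cinner_scaleC_right mult.assoc mult.left_commute)
  also have "\<dots> = complex_of_real ((cmod c * norm x)\<^sup>2)"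
    by (simp only: complex_norm_square[symmetric] cinner_self power_mult_distrib of_real_mult)
  finally have "(norm (c *\<^sub>C x))\<^sup>2 = (cmod c * norm x)\<^sup>2"
    using of_real_eq_iff by blast
  then show ?thesis
    by (simp add: power2_eq_iff_nonneg)
qed

lemma scaleC_scaleR_commute: "c *\<^sub>C (r *\<^sub>R x) = r *\<^sub>R (c *\<^sub>C x)"
  by (simp add: scaleR_scaleC scaleC_scaleC mult.commute)

text \<open>Rotating \<open>x\<close> by a unimodular \<open>c\<close> makes the inner product real
  and nonnegative, so that the real Cauchy-Schwarz inequality applies.\<close>

lemma cmod_cinner_le: "cmod (cinner x y) \<le> norm x * norm y"
proof -
  obtain c where c: "cmod c = 1" "c * cinner x y = complex_of_real (cmod (cinner x y))"
  proof (cases "cinner x y = 0")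
    case True
    then show ?thesis using that[of 1] by simp
  next
    case False
    define w where "w = cinner x y"
    have "cnj w / cmod w * w = complex_of_real (cmod w)"
      using False complex_norm_square[of w] by (simp add: w_def field_simps power2_eq_square)
    moreover have "cmod (cnj w / cmod w) = 1"
      using False by (simp add: w_def norm_divide)
    ultimately show ?thesis using that w_def by blast
  qed
  have "cmod (cinner x y) = Re (cinner (c *\<^sub>C x) y)"
    by (simp add: cinner_scaleC_left c)
  also have "\<dots> \<le> norm (c *\<^sub>C x) * norm y"
    by (simp add: Re_cinner norm_cauchy_schwarz)
  finally show ?thesis by (simp add: norm_scaleC c)
qed

lemma bounded_linear_cinner_left: "bounded_linear (\<lambda>x. cinner x y)"
  by (rule bounded_linear_intro[where K = "norm y"])
    (simp_all add: cinner_add_left cinner_scaleR_left scaleR_conv_of_real cmod_cinner_le)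

lemma bounded_linear_scaleC_left: "bounded_linear (\<lambda>c. c *\<^sub>C (x::'a::complex_inner))"
  by (rule bounded_linear_intro[where K = "norm x"])
    (simp_all add: scaleC_add_left scaleR_scaleC scaleC_scaleC norm_scaleC scaleR_conv_of_real)

lemma bounded_linear_scaleC_right: "bounded_linear (\<lambda>x::'a::complex_inner. c *\<^sub>C x)"
  by (rule bounded_linear_intro[where K = "cmod c"])
    (simp_all add: scaleC_add_right scaleC_scaleR_commute norm_scaleC)

lemma continuous_on_cinner_left [continuous_intros]:
  "continuous_on S f \<Longrightarrow> continuous_on S (\<lambda>x. cinner (f x) y)"
  by (rule bounded_linear.continuous_on[OF bounded_linear_cinner_left])

lemma csubspace_imp_subspace: "csubspace (M :: 'a::complex_inner set) \<Longrightarrow> subspace M"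
  unfolding subspace_def complex_vector.subspace_def by (simp add: scaleR_scaleC)

lemma csubspace_closure:
  fixes M :: "'a::complex_inner set"
  assumes "csubspace M"
  shows "csubspace (closure M)"
proof (rule complex_vector.subspaceI)
  show "0 \<in> closure M"
    using assms closure_subset[of M] by (auto simp: complex_vector.subspace_def)
  show "x + y \<in> closure M" if xy: "x \<in> closure M" "y \<in> closure M" for x y
  proof -
    obtain u v where "\<And>n. u n \<in> M" "u \<longlonglongrightarrow> x" "\<And>n. v n \<in> M" "v \<longlonglongrightarrow> y"
      using xy unfolding closure_sequential by blast
    then show ?thesis
      unfolding closure_sequential using assms
      by (intro exI[of _ "\<lambda>n. u n + v n"]) (simp add: tendsto_add complex_vector.subspace_add)
  qed
  show "c *\<^sub>C x \<in> closure M" if x: "x \<in> closure M" for c x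
  proof -
    obtain u where "\<And>n. u n \<in> M" "u \<longlonglongrightarrow> x"
      using x unfolding closure_sequential by blast
    then show ?thesis
      unfolding closure_sequential using assms
      by (intro exI[of _ "\<lambda>n. c *\<^sub>C u n"])
        (simp add: bounded_linear.tendsto[OF bounded_linear_scaleC_right] complex_vector.subspace_scale)
  qed
qed

section \<open>Orthonormal sets and finite-dimensional compactness\<close>

definition orthonormal :: "'a::complex_inner set \<Rightarrow> bool" where
  "orthonormal E \<longleftrightarrow> (\<forall>e\<in>E. norm e = 1) \<and> (\<forall>e\<in>E. \<forall>f\<in>E. e \<noteq> f \<longrightarrow> cinner e f = 0)"

lemma orthonormal_cinner:
  "orthonormal E \<Longrightarrow> e \<in> E \<Longrightarrow> f \<in> E \<Longrightarrow> cinner e f = (if e = f then 1 else 0)"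
  by (simp add: orthonormal_def cinner_self)

lemma orthonormal_subset: "orthonormal E \<Longrightarrow> A \<subseteq> E \<Longrightarrow> orthonormal A"
  by (auto simp: orthonormal_def subset_iff)

lemma orthonormal_norm: "orthonormal E \<Longrightarrow> e \<in> E \<Longrightarrow> norm e = 1"
  by (simp add: orthonormal_def)

lemma orthonormal_insert:
  assumes "orthonormal E" "norm x = 1" "\<And>e. e \<in> E \<Longrightarrow> cinner x e = 0"
  shows "orthonormal (insert x E)"
proof -
  have "cinner e x = 0" if "e \<in> E" for e
    using assms(3)[OF that] cinner_eq_0_commute by blast
  then show ?thesis using assms by (simp add: orthonormal_def)
qed

lemma cinner_orthonormal_sum:
  assumes "orthonormal A" "finite A" "f \<in> A"
  shows "cinner (\<Sum>e\<in>A. c e *\<^sub>C e) f = c f"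
proof -
  have "cinner (\<Sum>e\<in>A. c e *\<^sub>C e) f = (\<Sum>e\<in>A. if e = f then c e else 0)"
    unfolding cinner_sum_left
    by (rule sum.cong) (use assms in \<open>auto simp: cinner_scaleC_left orthonormal_cinner\<close>)
  then show ?thesis using assms by simp
qed

lemma cinner_orthonormal_sum_outside:
  assumes "orthonormal E" "A \<subseteq> E" "f \<in> E - A"
  shows "cinner (\<Sum>e\<in>A. c e *\<^sub>C e) f = 0"
  unfolding cinner_sum_left
  by (rule sum.neutral)
    (use assms in \<open>auto simp: cinner_scaleC_left orthonormal_cinner[of E] subset_iff\<close>)

text \<open>\<open>u\<close> is an indexed family, so that the formula also serves images
  \<open>T e\<close>, which are orthogonal but not normalized.\<close>

lemma norm_orthogonal_combination:
  fixes u :: "'b \<Rightarrow> 'a::complex_inner"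
  assumes "finite A" "\<And>i j. \<lbrakk>i \<in> A; j \<in> A; i \<noteq> j\<rbrakk> \<Longrightarrow> cinner (u i) (u j) = 0"
  shows "(norm (\<Sum>i\<in>A. c i *\<^sub>C u i))\<^sup>2 = (\<Sum>i\<in>A. (cmod (c i))\<^sup>2 * (norm (u i))\<^sup>2)"
proof -
  have "(norm (\<Sum>i\<in>A. c i *\<^sub>C u i))\<^sup>2 = (\<Sum>i\<in>A. (norm (c i *\<^sub>C u i))\<^sup>2)"
    using assms
    by (intro norm_sum_Pythagorean)
      (auto simp: pairwise_def cinner_scaleC_left cinner_scaleC_right
        intro!: cinner_eq_0_imp_orthogonal)
  then show ?thesis by (simp add: norm_scaleC power_mult_distrib)
qed

lemma norm_orthonormal_combination:
  assumes "orthonormal A" "finite A"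
  shows "(norm (\<Sum>e\<in>A. c e *\<^sub>C e))\<^sup>2 = (\<Sum>e\<in>A. (cmod (c e))\<^sup>2)"
proof -
  have "(norm (\<Sum>e\<in>A. c e *\<^sub>C e))\<^sup>2 = (\<Sum>e\<in>A. (cmod (c e))\<^sup>2 * (norm e)\<^sup>2)"
    using assms by (intro norm_orthogonal_combination) (auto simp: orthonormal_cinner)
  also have "\<dots> = (\<Sum>e\<in>A. (cmod (c e))\<^sup>2)"
    using assms by (intro sum.cong) (auto simp: orthonormal_norm)
  finally show ?thesis .
qed

lemma orthogonal_residual:
  assumes "orthonormal E" "finite E" "f \<in> E"
  shows "cinner (x - (\<Sum>e\<in>E. cinner x e *\<^sub>C e)) f = 0"
  using assms by (simp add: cinner_diff_left cinner_orthonormal_sum)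

lemma csubspace_orthogonal: "csubspace {z. \<forall>e\<in>E. cinner z e = 0}"
  by (rule complex_vector.subspaceI) (auto simp: cinner_add_left cinner_scaleC_left)

lemma closed_orthogonal:
  fixes E :: "'a::complex_inner set"
  shows "closed {z. \<forall>e\<in>E. cinner z e = 0}"
proof -
  have "closed {z. cinner z e = 0}" for e :: 'a
    by (intro closed_Collect_eq continuous_intros)
  then have "closed (\<Inter>e\<in>E. {z. cinner z e = 0})" by blast
  moreover have "(\<Inter>e\<in>E. {z. cinner z e = 0}) = {z. \<forall>e\<in>E. cinner z e = 0}" by auto
  ultimately show ?thesis by simp
qed

lemma cinner_eq_0_closure_cspan:
  fixes x :: "'a::complex_inner"
  assumes "\<And>e. e \<in> E \<Longrightarrow> cinner x e = 0" "y \<in> closure (cspan E)"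
  shows "cinner x y = 0"
proof -
  have "closure (cspan E) \<subseteq> {z. \<forall>e\<in>{x}. cinner z e = 0}"
    using assms(1)
    by (intro closure_minimal complex_vector.span_minimal csubspace_orthogonal closed_orthogonal)
      (auto simp: cinner_eq_0_commute)
  then show ?thesis using assms(2) cinner_eq_0_commute by blast
qed

lemma cspan_sum_mem: "A \<subseteq> E \<Longrightarrow> (\<Sum>e\<in>A. c e *\<^sub>C e) \<in> cspan E"
  by (intro complex_vector.span_sum complex_vector.span_scale complex_vector.span_base) blast

text \<open>Gram-Schmidt: the residual \<open>b - p\<close> either vanishes, so that
  \<open>b\<close> is redundant, or its normalization enlarges \<open>E\<close>.\<close>

lemma finite_orthonormal_basis:
  assumes "finite B"
  shows "\<exists>E :: 'a::complex_inner set. finite E \<and> orthonormal E \<and> cspan E = cspan B"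
  using assms
proof (induction B)
  case empty
  have "orthonormal {}" by (simp add: orthonormal_def)
  then show ?case by blast
next
  case (insert b B)
  then obtain E where E: "finite E" "orthonormal E" "cspan E = cspan B" by blast
  define p where "p = (\<Sum>e\<in>E. cinner b e *\<^sub>C e)"
  have p: "p \<in> cspan E" unfolding p_def by (rule cspan_sum_mem) simp
  show ?case
  proof (cases "b = p")
    case True
    then have "cspan (insert b B) = cspan B"
      using p E by (simp add: complex_vector.span_redundant)
    then show ?thesis using E by auto
  next
    case False
    define u where "u = inverse (norm (b - p)) *\<^sub>R (b - p)"
    have bu: "b = norm (b - p) *\<^sub>R u + p" using False by (simp add: u_def)
    have "norm u = 1" using False by (simp add: u_def)
    moreover have "cinner u e = 0" if "e \<in> E" for e
      using E that unfolding u_def p_def by (simp add: cinner_scaleR_left orthogonal_residual)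
    ultimately have on: "orthonormal (insert u E)" using E by (intro orthonormal_insert)
    have pI: "p \<in> cspan (insert x E)" for x
      using p complex_vector.span_mono[of E "insert x E"] by auto
    have pB: "p \<in> cspan (insert b B)"
      using p E complex_vector.span_mono[of B "insert b B"] by auto
    have "u \<in> cspan (insert b B)"
      unfolding u_def scaleR_scaleC
      by (intro complex_vector.span_scale complex_vector.span_diff pB complex_vector.span_base) simp
    moreover have "E \<subseteq> cspan (insert b B)"
      using E complex_vector.span_mono[of B "insert b B"] complex_vector.span_superset[of E] by auto
    moreover have "b \<in> cspan (insert u E)"
      using bu complex_vector.span_add[OF complex_vector.span_scale[OF complex_vector.span_base[of u "insert u E"]] pI[of u]]
      by (metis insertI1 scaleR_scaleC)
    moreover have "B \<subseteq> cspan (insert u E)"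
      using E complex_vector.span_mono[of E "insert u E"] complex_vector.span_superset[of B] by auto
    ultimately have "cspan (insert u E) = cspan (insert b B)"
      by (simp add: complex_vector.span_eq)
    then show ?thesis using on E by (intro exI[of _ "insert u E"]) auto
  qed
qed

text \<open>Zorn's lemma with \<open>P\<close> left open: \<open>P = UNIV\<close> serves to refute
  compactness of the ball, the set of eigenvectors of \<open>T\<close> to build the
  eigenbasis.\<close>

lemma maximal_orthonormal_subset:
  fixes P :: "'a::complex_inner set"
  obtains E where "orthonormal E" "E \<subseteq> P"
    "\<And>x. \<lbrakk>x \<in> P; norm x = 1; \<forall>e\<in>E. cinner x e = 0\<rbrakk> \<Longrightarrow> False"
proof -
  have "\<exists>M\<in>{E. orthonormal E \<and> E \<subseteq> P}. \<forall>X\<in>{E. orthonormal E \<and> E \<subseteq> P}. M \<subseteq> X \<longrightarrow> X = M"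
  proof (rule subset_Zorn')
    fix C assume C: "subset.chain {E. orthonormal E \<and> E \<subseteq> P} C"
    then have sub: "\<And>X. X \<in> C \<Longrightarrow> orthonormal X \<and> X \<subseteq> P"
      and lin: "\<And>X Y. X \<in> C \<Longrightarrow> Y \<in> C \<Longrightarrow> X \<subseteq> Y \<or> Y \<subseteq> X"
      by (auto simp: subset_chain_def)
    have "cinner e f = 0" if ef: "e \<in> \<Union>C" "f \<in> \<Union>C" "e \<noteq> f" for e f
    proof -
      obtain X Y where XY: "X \<in> C" "Y \<in> C" "e \<in> X" "f \<in> Y" using ef by blast
      then obtain Z where "Z \<in> C" "e \<in> Z" "f \<in> Z" using lin[of X Y] by blast
      then show ?thesis using sub[of Z] \<open>e \<noteq> f\<close> by (auto simp: orthonormal_def)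
    qed
    moreover have "norm e = 1" if "e \<in> \<Union>C" for e
      using that sub orthonormal_norm by blast
    ultimately have "orthonormal (\<Union>C)" unfolding orthonormal_def by blast
    moreover have "\<Union>C \<subseteq> P" using sub by blast
    ultimately show "\<Union>C \<in> {E. orthonormal E \<and> E \<subseteq> P}" by simp
  qed
  then obtain E where E: "orthonormal E" "E \<subseteq> P"
    and max: "\<And>X. \<lbrakk>orthonormal X; X \<subseteq> P; E \<subseteq> X\<rbrakk> \<Longrightarrow> X = E" by auto
  have False if x: "x \<in> P" "norm x = 1" "\<forall>e\<in>E. cinner x e = 0" for x
  proof -
    have "insert x E = E"
      using E x by (intro max orthonormal_insert) auto
    then have "cinner x x = 0" using x by blast
    then show False using x by (simp add: cinner_self)
  qed
  then show ?thesis using that E by blast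
qed

text \<open>If \<open>E\<close> were finite, the residual of every \<open>x\<close> would be
  orthogonal to \<open>E\<close>, hence zero, and \<open>E\<close> would span the space.\<close>

lemma total_orthonormal_infinite:
  fixes E :: "'a::complex_inner set"
  assumes "orthonormal E" "\<not> cfinite_dim (UNIV :: 'a set)"
    and total: "\<And>x. \<forall>e\<in>E. cinner x e = 0 \<Longrightarrow> x = 0"
  shows "infinite E"
proof
  assume fin: "finite E"
  have "x \<in> cspan E" for x
  proof -
    have "x - (\<Sum>e\<in>E. cinner x e *\<^sub>C e) = 0"
      using assms(1) fin by (intro total) (simp add: orthogonal_residual)
    then show ?thesis using cspan_sum_mem[of E E "cinner x"] by simp
  qed
  then have "cspan E = UNIV" by auto
  then show False using assms(2) fin unfolding cfinite_dim_def by blast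
qed

text \<open>Induction on coordinates: a new vector maps a disc times the previous compact set
  continuously onto the new set.\<close>

lemma compact_bounded_combinations:
  fixes A :: "'a::complex_inner set"
  assumes "finite A"
  shows "compact {\<Sum>e\<in>A. c e *\<^sub>C e | c. \<forall>e\<in>A. cmod (c e) \<le> r}"
  using assms
proof (induction A)
  case empty
  then show ?case by simp
next
  case (insert a A)
  let ?S = "{\<Sum>e\<in>A. c e *\<^sub>C e | c. \<forall>e\<in>A. cmod (c e) \<le> r}"
  have "{\<Sum>e\<in>insert a A. c e *\<^sub>C e | c. \<forall>e\<in>insert a A. cmod (c e) \<le> r} =
      (\<lambda>(z, x). z *\<^sub>C a + x) ` (cball 0 r \<times> ?S)" (is "?L = ?R")
  proof (intro equalityI subsetI)
    fix x assume "x \<in> ?L"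
    then obtain c where c: "x = (\<Sum>e\<in>insert a A. c e *\<^sub>C e)" "\<forall>e\<in>insert a A. cmod (c e) \<le> r"
      by blast
    then have "x = (\<lambda>(z, x). z *\<^sub>C a + x) (c a, \<Sum>e\<in>A. c e *\<^sub>C e)"
      using insert by simp
    moreover have "(c a, \<Sum>e\<in>A. c e *\<^sub>C e) \<in> cball 0 r \<times> ?S" using c by auto
    ultimately show "x \<in> ?R" by blast
  next
    fix x assume "x \<in> ?R"
    then obtain z c where c: "x = z *\<^sub>C a + (\<Sum>e\<in>A. c e *\<^sub>C e)" "cmod z \<le> r" "\<forall>e\<in>A. cmod (c e) \<le> r"
      by auto
    have "(\<Sum>e\<in>A. (c(a := z)) e *\<^sub>C e) = (\<Sum>e\<in>A. c e *\<^sub>C e)"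
      using insert by (intro sum.cong) auto
    then have "x = (\<Sum>e\<in>insert a A. (c(a := z)) e *\<^sub>C e)"
      using insert c by simp
    moreover have "\<forall>e\<in>insert a A. cmod ((c(a := z)) e) \<le> r" using c by simp
    ultimately show "x \<in> ?L" by blast
  qed
  moreover have "continuous_on (cball 0 r \<times> ?S) (\<lambda>(z, x). z *\<^sub>C a + x)"
    unfolding case_prod_unfold
    by (intro continuous_intros bounded_linear.continuous_on[OF bounded_linear_scaleC_left])
  moreover have "compact (cball (0::complex) r \<times> ?S)"
    using insert by (intro compact_Times compact_cball)
  ultimately show ?case
    using compact_continuous_image by simp
qed

lemma bounded_subset_compact_cspan:
  fixes E :: "'a::complex_inner set"
  assumes "finite E" "orthonormal E" "x \<in> cspan E" "norm x \<le> r"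
  shows "x \<in> {\<Sum>e\<in>E. c e *\<^sub>C e | c. \<forall>e\<in>E. cmod (c e) \<le> r}"
proof -
  obtain c where c: "x = (\<Sum>e\<in>E. c e *\<^sub>C e)"
    using assms complex_vector.span_finite[of E] by auto
  have "cmod (c e) \<le> r" if "e \<in> E" for e
  proof -
    have "c e = cinner x e" using assms that by (simp add: c cinner_orthonormal_sum)
    then show ?thesis
      using cmod_cinner_le[of x e] assms that by (simp add: orthonormal_norm)
  qed
  then show ?thesis using c by blast
qed

section \<open>Bounded and positive operators\<close>

lemma bounded_clinearD:
  assumes "bounded_clinear T"
  shows "bounded_linear T" "linear T" "T (c *\<^sub>C x) = c *\<^sub>C T x"
  using assms by (auto simp: bounded_clinear_def bounded_linear.linear)

lemma bounded_clinear_imp_clinear: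
  "bounded_clinear T \<Longrightarrow> Vector_Spaces.linear scaleC scaleC T"
  unfolding Vector_Spaces.linear_iff
  by (simp add: complex_vector.vector_space_axioms bounded_clinearD linear_add)

lemma bounded_clinear_scaleR: "bounded_clinear (\<lambda>x. a *\<^sub>R x)"
  by (simp add: bounded_clinear_def bounded_linear_scaleR_right scaleC_scaleR_commute)

lemma bounded_clinear_add:
  "bounded_clinear S \<Longrightarrow> bounded_clinear T \<Longrightarrow> bounded_clinear (\<lambda>x. S x + T x)"
  by (simp add: bounded_clinear_def bounded_linear_add scaleC_add_right)

lemma bounded_clinear_diff:
  "bounded_clinear S \<Longrightarrow> bounded_clinear T \<Longrightarrow> bounded_clinear (\<lambda>x. S x - T x)"
  by (simp add: bounded_clinear_def bounded_linear_sub complex_vector.scale_right_diff_distrib)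

text \<open>The discriminant argument, relative to \<open>M\<close>: the form of T^2 - m^2 is known
  to be nonnegative only on the subspace where \<open>m\<close> is the infimum.\<close>

lemma symmetric_form_Cauchy_Schwarz:
  fixes S :: "'a::real_inner \<Rightarrow> 'a"
  assumes "linear S" "subspace M"
    and sym: "\<And>x y. inner (S x) y = inner x (S y)"
    and nonneg: "\<And>x. x \<in> M \<Longrightarrow> 0 \<le> inner (S x) x"
    and "x \<in> M" "y \<in> M"
  shows "(inner (S x) y)\<^sup>2 \<le> inner (S x) x * inner (S y) y"
proof -
  define a b c where "a = inner (S x) x" and "b = inner (S x) y" and "c = inner (S y) y"
  have quad: "0 \<le> a + 2 * t * b + t\<^sup>2 * c" for t
  proof -
    have "0 \<le> inner (S (x + t *\<^sub>R y)) (x + t *\<^sub>R y)"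
      using assms by (intro nonneg subspace_add subspace_scale)
    also have "\<dots> = a + 2 * t * b + t\<^sup>2 * c"
      using sym[of y x]
      by (simp add: linear_add[OF \<open>linear S\<close>] linear_scale[OF \<open>linear S\<close>] inner_add_left inner_add_right
          a_def b_def c_def power2_eq_square algebra_simps inner_commute)
    finally show ?thesis .
  qed
  have "c \<ge> 0" unfolding c_def using assms by blast
  show ?thesis
  proof (cases "c = 0")
    case True
    have "b = 0"
    proof (rule ccontr)
      assume "b \<noteq> 0"
      \<comment> \<open>At this parameter the expression, affine in \<open>t\<close> since
        \<open>c = 0\<close>, takes the value -1.\<close>
      then show False using quad[of "- (a + 1) / (2 * b)"] True by (simp add: field_simps)
    qed
    then show ?thesis using True by (simp add: b_def c_def)
  next
    case False
    then have "c > 0" using \<open>c \<ge> 0\<close> by simp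
    have "0 \<le> c * (a + 2 * (- b / c) * b + (- b / c)\<^sup>2 * c)"
      using quad[of "- b / c"] \<open>c > 0\<close> by (intro mult_nonneg_nonneg) auto
    also have "\<dots> = a * c - b\<^sup>2"
      using \<open>c > 0\<close> by (simp add: field_simps power2_eq_square)
    finally show ?thesis by (simp add: a_def b_def c_def)
  qed
qed

text \<open>Cauchy-Schwarz with \<open>y = S x\<close> has the fourth power of
  \<open>norm (S x)\<close> on the left, and \<open>bound\<close> leaves its square on the right;
  dividing gives the claim. It converts knowledge of the form at one vector into knowledge of
  \<open>S x\<close> itself.\<close>

lemma norm_sq_le_form:
  fixes S :: "'a::real_inner \<Rightarrow> 'a"
  assumes "linear S" "subspace M"
    and sym: "\<And>x y. inner (S x) y = inner x (S y)"
    and nonneg: "\<And>x. x \<in> M \<Longrightarrow> 0 \<le> inner (S x) x"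
    and bound: "\<And>x. norm (S x) \<le> C * norm x"
    and "x \<in> M" "S x \<in> M"
  shows "(norm (S x))\<^sup>2 \<le> C * inner (S x) x"
proof (cases "S x = 0")
  case True
  then show ?thesis by simp
next
  case False
  let ?n = "(norm (S x))\<^sup>2"
  have "?n * ?n = (inner (S x) (S x))\<^sup>2"
    by (simp only: power2_norm_eq_inner) (simp add: power2_eq_square)
  also have "\<dots> \<le> inner (S x) x * inner (S (S x)) (S x)"
    using assms by (intro symmetric_form_Cauchy_Schwarz[of S M]) auto
  also have "\<dots> \<le> inner (S x) x * (C * ?n)"
  proof (rule mult_left_mono)
    have "inner (S (S x)) (S x) \<le> norm (S (S x)) * norm (S x)" by (rule norm_cauchy_schwarz)
    also have "\<dots> \<le> (C * norm (S x)) * norm (S x)" by (intro mult_right_mono bound) simp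
    finally show "inner (S (S x)) (S x) \<le> C * ?n" by (simp add: power2_eq_square)
  qed (use assms in blast)
  finally have "?n * ?n \<le> (C * inner (S x) x) * ?n" by (simp add: mult.commute mult.left_commute)
  moreover have "?n > 0" using False by simp
  ultimately show ?thesis by (rule mult_right_le_imp_le)
qed

lemma positive_op_form_nonneg: "positive_op T \<Longrightarrow> 0 \<le> inner (T x) x"
  unfolding positive_op_def by (metis Re_cinner complex_nonneg_Reals_iff)

text \<open>Symmetry follows from the reality of the quadratic form by complex polarization, so that the
  existence of adjoints (the Riesz representation theorem) is not needed.\<close>

lemma positive_op_symmetric:
  assumes "bounded_clinear T" "positive_op T"
  shows "cinner (T x) y = cinner x (T y)"
proof -
  define g where "g = (\<lambda>x y. cinner (T x) y - cinner x (T y))"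
  have lin: "T (x + y) = T x + T y" "T (c *\<^sub>C x) = c *\<^sub>C T x" for x y c
    using bounded_clinearD[OF assms(1)] by (auto simp: linear_add)
  have diag: "g z z = 0" for z
  proof -
    have "cinner (T z) z \<in> \<real>\<^sub>\<ge>\<^sub>0" using assms(2) by (simp add: positive_op_def)
    then have "cnj (cinner (T z) z) = cinner (T z) z"
      by (simp add: complex_nonneg_Reals_iff complex_eq_iff)
    then show ?thesis using cinner_commute[of z "T z"] by (simp add: g_def)
  qed
  have anti: "g u v + g v u = 0" for u v
  proof -
    have "g (u + v) (u + v) = g u u + g u v + g v u + g v v"
      by (simp add: g_def lin cinner_add_left cinner_add_right)
    then show ?thesis by (simp add: diag)
  qed
  have "g (\<i> *\<^sub>C x) y + g y (\<i> *\<^sub>C x) = \<i> * (g x y - g y x)"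
    by (simp add: g_def lin cinner_scaleC_left cinner_scaleC_right algebra_simps)
  then have "g x y = g y x" by (simp add: anti)
  then have "g x y = 0" using anti[of x y] by simp
  then show ?thesis by (simp add: g_def)
qed

lemma inner_symmetricI:
  "(\<And>x y. cinner (T x) y = cinner x (T y)) \<Longrightarrow> inner (T x) y = inner x (T y)"
  by (metis Re_cinner)

lemma positive_op_inner_symmetric:
  "bounded_clinear T \<Longrightarrow> positive_op T \<Longrightarrow> inner (T x) y = inner x (T y)"
  by (rule inner_symmetricI) (rule positive_op_symmetric)

lemma positive_opI:
  assumes sym: "\<And>x y. cinner (T x) y = cinner x (T y)"
    and nonneg: "\<And>x. 0 \<le> inner (T x) x"
  shows "positive_op T"
proof -
  have "cinner (T x) x \<in> \<real>\<^sub>\<ge>\<^sub>0" for x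
  proof -
    have "Im (cinner (T x) x) = 0"
      using arg_cong[OF cinner_commute[of "T x" x], of Im] sym[of x x] by simp
    then show ?thesis using nonneg by (simp add: complex_nonneg_Reals_iff Re_cinner)
  qed
  then show ?thesis unfolding positive_op_def using cadjoint_eqI[OF sym] by simp
qed

section \<open>Minimum modulus on a subspace and limits of minimizing sequences\<close>

lemma min_attaining_onI:
  assumes "x \<in> M" "norm x = 1" "\<And>y. \<lbrakk>y \<in> M; norm y = 1\<rbrakk> \<Longrightarrow> norm (T x) \<le> norm (T y)"
  shows "min_attaining_on M T"
proof -
  have "min_modulus_on M T = norm (T x)"
    unfolding min_modulus_on_def using assms by (intro cInf_eq_minimum) auto
  then show ?thesis using assms unfolding min_attaining_on_def by auto
qed

lemma min_modulus_on_le: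
  assumes "y \<in> M" "norm y = 1"
  shows "min_modulus_on M T \<le> norm (T y)"
  unfolding min_modulus_on_def
  by (rule cInf_lower) (use assms in \<open>auto intro: bdd_belowI[of _ 0]\<close>)

lemma min_modulus_on_mult_le:
  assumes "linear T" "subspace M" "z \<in> M"
  shows "min_modulus_on M T * norm z \<le> norm (T z)"
proof (cases "z = 0")
  case False
  define w where "w = inverse (norm z) *\<^sub>R z"
  have "w \<in> M" "norm w = 1" using False assms by (simp_all add: w_def subspace_scale)
  then have "min_modulus_on M T \<le> norm (T w)" by (rule min_modulus_on_le)
  also have "\<dots> = inverse (norm z) * norm (T z)"
    by (simp add: w_def linear_scale[OF assms(1)])
  finally show ?thesis using False by (simp add: field_simps)
qed simp

lemma exists_unit_vector:
  assumes "csubspace M" "M \<noteq> {0}"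
  shows "\<exists>x::'a::complex_inner\<in>M. norm x = 1"
proof -
  obtain y where "y \<in> M" "y \<noteq> 0"
    using assms complex_vector.subspace_0 by blast
  then show ?thesis
    using assms complex_vector.subspace_scale
    by (intro bexI[of _ "inverse (norm y) *\<^sub>R y"]) (auto simp: scaleR_scaleC[of "inverse _"] norm_scaleC norm_inverse)
qed

lemma finite_rank_imp_compact_op:
  fixes F :: "'a::complex_inner \<Rightarrow> 'b::complex_inner"
  assumes "finite_rank_op F"
  shows "compact_op F"
proof -
  have bl: "bounded_clinear F" using assms by (simp add: finite_rank_op_def)
  obtain B where "finite B" "cspan B = range F"
    using assms by (auto simp: finite_rank_op_def cfinite_dim_def)
  then obtain E where E: "finite E" "orthonormal E" "cspan E = range F"
    using finite_orthonormal_basis by metis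
  obtain r where r: "\<And>x. norm (F x) \<le> norm x * r" "r \<ge> 0"
    using bounded_linear.nonneg_bounded[OF bounded_clinearD(1)[OF bl]] by blast
  let ?C = "{\<Sum>e\<in>E. c e *\<^sub>C e | c. \<forall>e\<in>E. cmod (c e) \<le> r}"
  have C: "compact ?C" using E by (intro compact_bounded_combinations)
  have "F ` cball 0 1 \<subseteq> ?C"
  proof (rule image_subsetI)
    fix x :: 'a assume "x \<in> cball 0 1"
    then have "norm (F x) \<le> r"
      using r(1)[of x] r(2) mult_right_mono[of "norm x" 1 r] by simp
    then show "F x \<in> ?C" using E by (intro bounded_subset_compact_cspan) auto
  qed
  then have "closure (F ` cball 0 1) \<subseteq> ?C" using C by (intro closure_minimal compact_imp_closed)
  then have "compact (closure (F ` cball 0 1))"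
    using compact_Int_closed[OF C closed_closure, of "F ` cball 0 1"] by (simp add: Int_absorb1)
  then show ?thesis using bl by (simp add: compact_op_def)
qed

lemma min_attaining_on_finite_dim:
  fixes T :: "'a::complex_inner \<Rightarrow> 'b::complex_inner"
  assumes "bounded_clinear T" "finite B" "M = cspan B" "closed M" "M \<noteq> {0}"
  shows "min_attaining_on M T"
proof -
  obtain E where E: "finite E" "orthonormal E" "cspan E = cspan B"
    using assms finite_orthonormal_basis by metis
  let ?C = "{\<Sum>e\<in>E. c e *\<^sub>C e | c. \<forall>e\<in>E. cmod (c e) \<le> 1}"
  have "M \<inter> sphere 0 1 \<subseteq> ?C"
  proof
    fix x assume "x \<in> M \<inter> sphere 0 1"
    then show "x \<in> ?C" using E assms by (intro bounded_subset_compact_cspan) auto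
  qed
  moreover have sphere: "closed (sphere (0::'a) 1)"
    unfolding sphere_def by (intro closed_Collect_eq continuous_intros)
  ultimately have "M \<inter> sphere 0 1 = ?C \<inter> (M \<inter> sphere 0 1)" by blast
  moreover have "compact (?C \<inter> (M \<inter> sphere 0 1))"
    by (rule compact_Int_closed[OF compact_bounded_combinations[OF E(1)] closed_Int[OF assms(4) sphere]])
  ultimately have compact: "compact (M \<inter> sphere 0 1)" by simp
  have nonempty: "M \<inter> sphere 0 1 \<noteq> {}"
    using exists_unit_vector[of M] assms by (auto simp: complex_vector.subspace_span)
  have continuous: "continuous_on (M \<inter> sphere 0 1) (\<lambda>x. norm (T x))"
    by (intro continuous_on_norm linear_continuous_on bounded_clinearD assms)
  obtain x where x: "x \<in> M \<inter> sphere 0 1" and min: "\<forall>y\<in>M \<inter> sphere 0 1. norm (T x) \<le> norm (T y)"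
    using continuous_attains_inf[OF compact nonempty continuous] by (elim bexE)
  show ?thesis
  proof (rule min_attaining_onI)
    show "x \<in> M" "norm x = 1" using x by auto
    show "norm (T x) \<le> norm (T y)" if "y \<in> M" "norm y = 1" for y
      using min that by simp
  qed
qed

text \<open>The common end of two minimization arguments: the parallelogram identity bounds squared
  distances by excesses \<open>a\<close> over the infimum, and \<open>y\<close> absorbs a compact
  perturbation. The nearest point problem has \<open>C = 0\<close>; for minimizing sequences of
  \<open>T\<close>, \<open>y\<close> is their image under \<open>K\<close>.\<close>

lemma Cauchy_of_dist_sq_le:
  fixes x :: "nat \<Rightarrow> 'a::metric_space" and y :: "nat \<Rightarrow> 'b::metric_space" and a :: "nat \<Rightarrow> real"
  assumes "a \<longlonglongrightarrow> 0" "Cauchy y" "C \<ge> 0"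
    and le: "\<And>i j. (dist (x i) (x j))\<^sup>2 \<le> a i + a j + C * dist (y i) (y j)"
  shows "Cauchy x"
proof (rule metric_CauchyI)
  fix e :: real assume "e > 0"
  \<comment> \<open>Each of the three terms is to contribute at most e^2/3; \<open>C + 1\<close>
    keeps the denominator positive when \<open>C = 0\<close>.\<close>
  define d where "d = e\<^sup>2 / 3 / (C + 1)"
  have d: "d > 0" using \<open>e > 0\<close> \<open>C \<ge> 0\<close> by (simp add: d_def)
  have "eventually (\<lambda>n. a n < e\<^sup>2 / 3) sequentially"
    using assms(1) \<open>e > 0\<close> by (intro order_tendstoD) auto
  then obtain N1 where N1: "\<And>n. n \<ge> N1 \<Longrightarrow> a n < e\<^sup>2 / 3"
    by (auto simp: eventually_sequentially)
  obtain N2 where N2: "\<And>i j. i \<ge> N2 \<Longrightarrow> j \<ge> N2 \<Longrightarrow> dist (y i) (y j) < d"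
    using metric_CauchyD[OF assms(2) d] by blast
  have "dist (x i) (x j) < e" if "i \<ge> max N1 N2" "j \<ge> max N1 N2" for i j
  proof -
    have "C * dist (y i) (y j) \<le> (C + 1) * d"
      using N2[of i j] that \<open>C \<ge> 0\<close> by (intro mult_mono) auto
    also have "\<dots> = e\<^sup>2 / 3"
      using \<open>C \<ge> 0\<close> nonzero_mult_div_cancel_left[of "C + 1" "e\<^sup>2 / 3"]
      unfolding d_def times_divide_eq_right[of "C + 1" "e\<^sup>2 / 3"] by linarith
    finally have "(dist (x i) (x j))\<^sup>2 < e\<^sup>2"
      using le[of i j] N1[of i] N1[of j] that by simp
    then show ?thesis using \<open>e > 0\<close> by (simp add: power2_less_imp_less)
  qed
  then show "\<exists>M. \<forall>m\<ge>M. \<forall>n\<ge>M. dist (x m) (x n) < e" by blast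
qed

text \<open>The projection argument: \<open>z\<close> is \<open>x\<close> minus its nearest point in
  \<open>N\<close>, the limit of a minimizing sequence.\<close>

lemma exists_orthogonal_vector:
  fixes N :: "'a::chilbert_space set"
  assumes "csubspace N" "closed N" "x \<notin> N"
  obtains z where "z \<noteq> 0" "\<And>y. y \<in> N \<Longrightarrow> cinner z y = 0"
proof -
  have sub: "subspace N" using assms by (simp add: csubspace_imp_subspace)
  then have ne: "N \<noteq> {}" using subspace_0 by blast
  define d where "d = infdist x N"
  have "\<exists>y\<in>N. dist x y < d + inverse (real (Suc k))" for k
  proof -
    have "(INF a\<in>N. dist x a) < d + inverse (real (Suc k))"
      using ne by (simp add: d_def infdist_notempty)
    then show ?thesis using ne by (subst (asm) cINF_less_iff) auto
  qed
  then obtain u where u: "\<And>k. u k \<in> N" "\<And>k. dist x (u k) < d + inverse (real (Suc k))"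
    by metis
  have lim: "(\<lambda>k. dist x (u k)) \<longlonglongrightarrow> d"
  proof (rule tendsto_sandwich)
    show "eventually (\<lambda>k. d \<le> dist x (u k)) sequentially"
      using u by (simp add: d_def infdist_le)
    show "eventually (\<lambda>k. dist x (u k) \<le> d + inverse (real (Suc k))) sequentially"
      using u by (simp add: less_imp_le)
    show "(\<lambda>k. d + inverse (real (Suc k))) \<longlonglongrightarrow> d"
      using tendsto_add[OF tendsto_const LIMSEQ_inverse_real_of_nat, of d] by simp
  qed simp
  have "Cauchy u"
  proof (rule Cauchy_of_dist_sq_le)
    show "(\<lambda>k. 2 * (dist x (u k))\<^sup>2 - 2 * d\<^sup>2) \<longlonglongrightarrow> 0"
      using tendsto_diff[OF tendsto_mult_left[OF tendsto_power[OF lim, of 2], of 2] tendsto_const[of "2 * d\<^sup>2"]]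
      by simp
    show "Cauchy (\<lambda>_::nat. 0::real)" by (simp add: convergent_Cauchy convergent_const)
    show "(dist (u i) (u j))\<^sup>2 \<le> (2 * (dist x (u i))\<^sup>2 - 2 * d\<^sup>2) + (2 * (dist x (u j))\<^sup>2 - 2 * d\<^sup>2)
        + 0 * dist (0::real) 0" for i j
    proof -
      \<comment> \<open>The midpoint stays in \<open>N\<close>, so its distance to \<open>x\<close>
        is at least \<open>d\<close>; the parallelogram identity for \<open>x - u i\<close> and
        \<open>x - u j\<close> does the rest.\<close>
      let ?m = "(1/2) *\<^sub>R (u i + u j)"
      have "?m \<in> N" using u sub by (intro subspace_scale subspace_add)
      then have "d \<le> dist x ?m" by (simp add: d_def infdist_le)
      moreover have "0 \<le> d" by (simp add: d_def infdist_nonneg)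
      ultimately have "d\<^sup>2 \<le> (dist x ?m)\<^sup>2" by (simp add: power_mono)
      moreover have "(dist (u i) (u j))\<^sup>2 + 4 * (dist x ?m)\<^sup>2 = 2 * (dist x (u i))\<^sup>2 + 2 * (dist x (u j))\<^sup>2"
        unfolding dist_norm power2_norm_eq_inner
        by (simp add: inner_diff_left inner_diff_right inner_add_left inner_add_right inner_commute algebra_simps)
      ultimately show ?thesis by simp
    qed
  qed simp
  then obtain n where n: "u \<longlonglongrightarrow> n" using Cauchy_convergent_iff convergent_def by blast
  have "n \<in> N" using assms(2) u n closed_sequential_limits by blast
  have "dist x n = d"
    using LIMSEQ_unique[OF tendsto_dist[OF tendsto_const n] lim] .
  then have min: "norm (x - n) \<le> norm (x - y)" if "y \<in> N" for y
    using infdist_le[OF that, of x] by (simp add: d_def dist_norm)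
  define z where "z = x - n"
  have re: "inner z y = 0" if "y \<in> N" for y
  proof (cases "y = 0")
    case False
    define t where "t = inner z y / inner y y"
    have "n + t *\<^sub>R y \<in> N" using sub \<open>n \<in> N\<close> that by (intro subspace_add subspace_scale)
    from min[OF this] have "(norm z)\<^sup>2 \<le> (norm (z - t *\<^sub>R y))\<^sup>2"
      by (simp add: z_def diff_diff_eq power_mono)
    then have "2 * t * inner z y \<le> t\<^sup>2 * inner y y"
      unfolding power2_norm_eq_inner
      by (simp add: inner_diff_left inner_diff_right inner_commute algebra_simps power2_eq_square)
    then have "(inner z y)\<^sup>2 / inner y y \<le> 0"
      using False by (simp add: t_def power2_eq_square)
    moreover have "inner y y > 0" using False by simp
    ultimately show ?thesis by (simp add: divide_le_0_iff)
  qed simp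
  have "cinner z y = 0" if "y \<in> N" for y
  proof (rule complex_eqI)
    show "Re (cinner z y) = Re 0" using re[OF that] by (simp add: Re_cinner)
    \<comment> \<open>The real inner product of \<open>z\<close> with i times \<open>y\<close> is
      the imaginary part of \<open>cinner z y\<close>.\<close>
    have "\<i> *\<^sub>C y \<in> N" using that assms complex_vector.subspace_scale by blast
    then show "Im (cinner z y) = Im 0"
      using re[of "\<i> *\<^sub>C y"] by (simp add: Re_cinner[symmetric] cinner_scaleC_right)
  qed
  moreover have "z \<noteq> 0" using \<open>n \<in> N\<close> assms by (auto simp: z_def)
  ultimately show ?thesis using that by blast
qed

text \<open>Maximality delivers totality; a vector orthogonal to a proper closed subspace turns it
  into density, the form in which estimates are extended from finite combinations.\<close>

lemma total_imp_closure_cspan_UNIV: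
  fixes E :: "'a::chilbert_space set"
  assumes "\<And>x. \<forall>e\<in>E. cinner x e = 0 \<Longrightarrow> x = 0"
  shows "closure (cspan E) = UNIV"
proof (rule ccontr)
  assume "closure (cspan E) \<noteq> UNIV"
  then obtain x where "x \<notin> closure (cspan E)" by blast
  then obtain z where "z \<noteq> 0" and z: "\<And>y. y \<in> closure (cspan E) \<Longrightarrow> cinner z y = 0"
    using exists_orthogonal_vector[of "closure (cspan E)" x]
    by (metis closed_closure complex_vector.subspace_span csubspace_closure)
  have "cinner z e = 0" if "e \<in> E" for e
    using z closure_subset[of "cspan E"] complex_vector.span_base[OF that] by blast
  then show False using assms \<open>z \<noteq> 0\<close> by blast
qed

section \<open>Operators with a decomposition\<close>

lemma AM_decomposition_bounded_clinear:
  "AM_decomposition T \<alpha> K F \<Longrightarrow> bounded_clinear T"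
  unfolding AM_decomposition_def
  by (auto intro!: bounded_clinear_add bounded_clinear_diff bounded_clinear_scaleR)

lemma AM_decomposition_diff:
  "AM_decomposition T \<alpha> K F \<Longrightarrow> K x - F x = \<alpha> *\<^sub>R x - T x"
  by (simp add: AM_decomposition_def)

lemma AM_decomposition_norm_K:
  assumes "AM_decomposition T \<alpha> K F"
  shows "norm (K x) \<le> \<alpha> * norm x"
proof -
  have "norm (K x) \<le> onorm K * norm x"
    using assms by (intro onorm bounded_clinearD) (simp add: AM_decomposition_def)
  also have "\<dots> \<le> \<alpha> * norm x"
    using assms by (intro mult_right_mono) (auto simp: AM_decomposition_def)
  finally show ?thesis .
qed

lemma AM_decomposition_positive:
  assumes "AM_decomposition T \<alpha> K F"
  shows "positive_op T"
proof (rule positive_opI)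
  have KF: "bounded_clinear K" "positive_op K" "bounded_clinear F" "positive_op F"
    and T: "T = (\<lambda>x. \<alpha> *\<^sub>R x - K x + F x)"
    using assms by (auto simp: AM_decomposition_def)
  show "cinner (T x) y = cinner x (T y)" for x y
    using KF positive_op_symmetric[of K] positive_op_symmetric[of F]
    by (simp add: T cinner_add_left cinner_add_right cinner_diff_left cinner_diff_right
        cinner_scaleR_left cinner_scaleR_right)
  show "0 \<le> inner (T x) x" for x
  proof -
    have "inner (K x) x \<le> norm (K x) * norm x" by (rule norm_cauchy_schwarz)
    also have "\<dots> \<le> \<alpha> * norm x * norm x"
      by (intro mult_right_mono AM_decomposition_norm_K[OF assms]) simp
    also have "\<dots> = \<alpha> * inner x x" by (simp add: power2_norm_eq_inner[symmetric] power2_eq_square)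
    finally show ?thesis
      using positive_op_form_nonneg[OF KF(4), of x] by (simp add: T inner_add_left inner_diff_left)
  qed
qed

text \<open>The mixed term of \<open>K\<close> and \<open>F\<close> vanishes because
  \<open>K\<close> is symmetric and \<open>K (F x) = 0\<close>.\<close>

lemma AM_decomposition_norm_sq:
  assumes "AM_decomposition T \<alpha> K F"
  shows "(norm (T x))\<^sup>2 = \<alpha>\<^sup>2 * (norm x)\<^sup>2 + (norm (K x))\<^sup>2 + (norm (F x))\<^sup>2
    - 2 * \<alpha> * inner (K x) x + 2 * \<alpha> * inner (F x) x"
proof -
  have KF: "bounded_clinear K" "positive_op K" "K (F x) = 0"
    and T: "T = (\<lambda>x. \<alpha> *\<^sub>R x - K x + F x)"
    using assms by (auto simp: AM_decomposition_def fun_eq_iff)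
  have "inner (K x) (F x) = 0"
    using KF(3) positive_op_inner_symmetric[OF KF(1,2)] by simp
  then show ?thesis
    unfolding T power2_norm_eq_inner
    by (simp add: inner_add_left inner_add_right inner_diff_left inner_diff_right inner_commute
        power2_eq_square algebra_simps)
qed

lemma AM_decomposition_norm_sq_lower:
  assumes "AM_decomposition T \<alpha> K F"
  shows "\<alpha>\<^sup>2 * (norm x)\<^sup>2 \<le> (norm (T x))\<^sup>2 + 2 * \<alpha> * (norm (K x) * norm x)"
proof -
  have \<alpha>: "\<alpha> \<ge> 0" and F: "positive_op F" using assms by (auto simp: AM_decomposition_def)
  have "2 * \<alpha> * inner (K x) x \<le> 2 * \<alpha> * (norm (K x) * norm x)"
    using \<alpha> by (intro mult_left_mono norm_cauchy_schwarz) auto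
  moreover have "0 \<le> 2 * \<alpha> * inner (F x) x"
    using \<alpha> positive_op_form_nonneg[OF F, of x] by simp
  moreover have "0 \<le> (norm (K x))\<^sup>2 + (norm (F x))\<^sup>2" by simp
  ultimately show ?thesis
    unfolding AM_decomposition_norm_sq[OF assms] by linarith
qed

text \<open>The square of \<open>norm (K x)\<close> is at most \<alpha>
  \<open>inner (K x) x\<close>, so the mixed term, twice as large and negative, outweighs it. Hence
  a unit vector of \<open>M\<close> in the kernel of \<open>F\<close> is a minimizer once the
  infimum is at least \<alpha>.\<close>

lemma AM_decomposition_norm_le:
  assumes "AM_decomposition T \<alpha> K F" "F x = 0"
  shows "norm (T x) \<le> \<alpha> * norm x"
proof -
  have \<alpha>: "\<alpha> \<ge> 0" and K: "bounded_clinear K" "positive_op K"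
    using assms by (auto simp: AM_decomposition_def)
  have "(norm (K x))\<^sup>2 \<le> \<alpha> * inner (K x) x"
    using K AM_decomposition_norm_K[OF assms(1)]
    by (intro norm_sq_le_form[of K UNIV] bounded_clinearD positive_op_inner_symmetric
        positive_op_form_nonneg) auto
  moreover have "0 \<le> \<alpha> * inner (K x) x" using \<alpha> K by (simp add: positive_op_form_nonneg)
  ultimately have "(norm (T x))\<^sup>2 \<le> (\<alpha> * norm x)\<^sup>2"
    unfolding AM_decomposition_norm_sq[OF assms(1)] by (simp add: assms(2) power_mult_distrib)
  then show ?thesis by (rule power2_le_imp_le) (simp add: \<alpha>)
qed

text \<open>Minimizing sequences converge when the infimum lies below \<open>\<alpha>\<close>, because the form
  \<open>\<parallel>T z\<parallel>\<^sup>2 - m\<^sup>2 \<parallel>z\<parallel>\<^sup>2\<close> then dominates \<open>\<parallel>z\<parallel>\<^sup>2\<close> up to the compact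
  operator \<open>K\<close>.\<close>

lemma AM_decomposition_attaining_below:
  fixes T :: "'a::chilbert_space \<Rightarrow> 'a"
  assumes dec: "AM_decomposition T \<alpha> K F"
    and M: "csubspace M" "closed M" "M \<noteq> {0}"
    and less: "min_modulus_on M T < \<alpha>"
  shows "min_attaining_on M T"
proof -
  define m where "m = min_modulus_on M T"
  have T: "bounded_clinear T" using dec by (rule AM_decomposition_bounded_clinear)
  have K: "bounded_clinear K" "compact (closure (K ` cball 0 1))" and \<alpha>: "\<alpha> \<ge> 0"
    using dec by (auto simp: AM_decomposition_def compact_op_def)
  have sub: "subspace M" using M by (simp add: csubspace_imp_subspace)
  let ?V = "{norm (T x) | x. x \<in> M \<and> norm x = 1}"
  have ne: "?V \<noteq> {}" using exists_unit_vector[OF M(1,3)] by blast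
  have "m \<ge> 0"
    unfolding m_def min_modulus_on_def using ne by (intro cInf_greatest) auto
  have lower: "m * norm z \<le> norm (T z)" if "z \<in> M" for z
    unfolding m_def by (rule min_modulus_on_mult_le[OF bounded_clinearD(2)[OF T] sub that])
  have "\<exists>x\<in>M. norm x = 1 \<and> norm (T x) < m + inverse (real (Suc k))" for k
  proof -
    have "Inf ?V < m + inverse (real (Suc k))" by (simp add: m_def min_modulus_on_def)
    from cInf_lessD[OF ne this] show ?thesis by blast
  qed
  then obtain x where x: "\<And>k. x k \<in> M" "\<And>k. norm (x k) = 1"
    "\<And>k. norm (T (x k)) < m + inverse (real (Suc k))" by metis
  have limT: "(\<lambda>k. norm (T (x k))) \<longlonglongrightarrow> m"
  proof (rule tendsto_sandwich)
    show "eventually (\<lambda>k. m \<le> norm (T (x k))) sequentially"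
      using lower x by (metis (mono_tags) eventuallyI mult.right_neutral)
    show "eventually (\<lambda>k. norm (T (x k)) \<le> m + inverse (real (Suc k))) sequentially"
      using x by (simp add: less_imp_le)
    show "(\<lambda>k. m + inverse (real (Suc k))) \<longlonglongrightarrow> m"
      using tendsto_add[OF tendsto_const LIMSEQ_inverse_real_of_nat, of m] by simp
  qed simp
  have "K (x k) \<in> closure (K ` cball 0 1)" for k
    using closure_subset x(2)[of k] by (intro subsetD[OF closure_subset] imageI) simp
  \<comment> \<open>Compactness of \<open>K\<close> selects a subsequence whose images under
    \<open>K\<close> converge; the vectors themselves are then shown to converge.\<close>
  then obtain l r where r: "strict_mono r" "((\<lambda>k. K (x k)) \<circ> r) \<longlonglongrightarrow> l"
    using K(2)[unfolded compact_def, THEN spec, of "\<lambda>k. K (x k)"] by auto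
  define y where "y = (\<lambda>k. x (r k))"
  have y: "y k \<in> M" "norm (y k) = 1" for k by (simp_all add: y_def x)
  have limTy: "(\<lambda>k. norm (T (y k))) \<longlonglongrightarrow> m"
    using LIMSEQ_subseq_LIMSEQ[OF limT r(1)] by (simp add: y_def o_def)
  define \<delta> where "\<delta> = \<alpha>\<^sup>2 - m\<^sup>2"
  have "\<delta> > 0"
    using less \<open>m \<ge> 0\<close> by (simp add: \<delta>_def m_def[symmetric] power_strict_mono)
  have "Cauchy y"
  proof (rule Cauchy_of_dist_sq_le)
    show "(\<lambda>k. 2 * ((norm (T (y k)))\<^sup>2 - m\<^sup>2) / \<delta>) \<longlonglongrightarrow> 0"
    proof -
      have "(\<lambda>k. 2 * ((norm (T (y k)))\<^sup>2 - m\<^sup>2) / \<delta>) \<longlonglongrightarrow> 2 * (m\<^sup>2 - m\<^sup>2) / \<delta>"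
        using \<open>\<delta> > 0\<close> by (intro tendsto_intros limTy) simp
      then show ?thesis by simp
    qed
    show "Cauchy (\<lambda>k. K (y k))"
      using r(2) by (auto simp: y_def o_def intro: LIMSEQ_imp_Cauchy)
    show "0 \<le> 4 * \<alpha> / \<delta>" using \<alpha> \<open>\<delta> > 0\<close> by simp
    show "(dist (y i) (y j))\<^sup>2 \<le> 2 * ((norm (T (y i)))\<^sup>2 - m\<^sup>2) / \<delta> + 2 * ((norm (T (y j)))\<^sup>2 - m\<^sup>2) / \<delta>
        + 4 * \<alpha> / \<delta> * dist (K (y i)) (K (y j))" for i j
    proof -
      \<comment> \<open>Parallelogram identity for \<open>T\<close>: since \<open>s\<close> is in
        \<open>M\<close>, \<open>norm (T s)\<close> is at least \<open>m * norm s\<close>, which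
        bounds \<open>norm (T z)\<close> from above. Comparison with the lower bound involving
        \<alpha>^2 leaves the factor \<delta> in front of the square of
        \<open>norm z\<close>.\<close>
      define z where "z = y i - y j"
      define s where "s = y i + y j"
      have "s \<in> M" using sub y by (simp add: s_def subspace_add)
      then have "(m * norm s)\<^sup>2 \<le> (norm (T s))\<^sup>2"
        using lower \<open>m \<ge> 0\<close> by (intro power_mono) auto
      moreover have "(norm (T z))\<^sup>2 + (norm (T s))\<^sup>2 = 2 * (norm (T (y i)))\<^sup>2 + 2 * (norm (T (y j)))\<^sup>2"
        unfolding z_def s_def power2_norm_eq_inner
        by (simp add: linear_add[OF bounded_clinearD(2)[OF T]] linear_diff[OF bounded_clinearD(2)[OF T]]
            inner_diff_left inner_diff_right inner_add_left inner_add_right)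
      moreover have "(norm z)\<^sup>2 + (norm s)\<^sup>2 = 2 * (norm (y i))\<^sup>2 + 2 * (norm (y j))\<^sup>2"
        unfolding z_def s_def power2_norm_eq_inner
        by (simp add: inner_diff_left inner_diff_right inner_add_left inner_add_right)
      then have "(m * norm s)\<^sup>2 = m\<^sup>2 * (4 - (norm z)\<^sup>2)"
        by (simp add: y power_mult_distrib)
      moreover have "\<alpha>\<^sup>2 * (norm z)\<^sup>2 \<le> (norm (T z))\<^sup>2 + 2 * \<alpha> * (norm (K z) * norm z)"
        by (rule AM_decomposition_norm_sq_lower[OF dec])
      moreover have "2 * \<alpha> * (norm (K z) * norm z) \<le> 2 * \<alpha> * (norm (K z) * 2)"
        using \<alpha> norm_triangle_ineq4[of "y i" "y j"] y
        by (intro mult_left_mono) (auto simp: z_def)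
      ultimately have "\<delta> * (norm z)\<^sup>2 \<le> 2 * ((norm (T (y i)))\<^sup>2 - m\<^sup>2) + 2 * ((norm (T (y j)))\<^sup>2 - m\<^sup>2)
          + 4 * \<alpha> * norm (K z)"
        unfolding \<delta>_def by (simp add: algebra_simps)
      then have "(norm z)\<^sup>2 \<le> (2 * ((norm (T (y i)))\<^sup>2 - m\<^sup>2) + 2 * ((norm (T (y j)))\<^sup>2 - m\<^sup>2)
          + 4 * \<alpha> * norm (K z)) / \<delta>"
        using \<open>\<delta> > 0\<close> by (simp add: pos_le_divide_eq mult.commute)
      then show ?thesis
        by (simp add: dist_norm z_def linear_diff[OF bounded_clinearD(2)[OF K(1)]] add_divide_distrib
            diff_divide_distrib)
    qed
  qed
  then obtain x0 where x0: "y \<longlonglongrightarrow> x0" using Cauchy_convergent_iff convergent_def by blast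
  have "x0 \<in> M" using M(2) y(1) x0 closed_sequential_limits by blast
  moreover have "norm x0 = 1"
    using LIMSEQ_unique[OF tendsto_norm[OF x0]] y(2) by simp
  moreover have "norm (T x0) = m"
    using LIMSEQ_unique[OF tendsto_norm[OF bounded_linear.tendsto[OF bounded_clinearD(1)[OF T] x0]] limTy] .
  ultimately show ?thesis unfolding min_attaining_on_def m_def by blast
qed

lemma AM_decomposition_imp_abs_min_attaining:
  fixes T :: "'a::chilbert_space \<Rightarrow> 'a"
  assumes dec: "AM_decomposition T \<alpha> K F"
  shows "abs_min_attaining T"
  unfolding abs_min_attaining_def
proof (intro allI impI, elim conjE)
  fix M :: "'a set" assume M: "csubspace M" "closed M" "M \<noteq> {0}"
  have T: "bounded_clinear T" using dec by (rule AM_decomposition_bounded_clinear)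
  have F: "bounded_clinear F" "finite_rank_op F" using dec by (auto simp: AM_decomposition_def)
  consider "min_modulus_on M T < \<alpha>"
    | x where "\<alpha> \<le> min_modulus_on M T" "x \<in> M" "x \<noteq> 0" "F x = 0"
    | "\<And>x. x \<in> M \<Longrightarrow> F x = 0 \<Longrightarrow> x = 0" by force
  then show "min_attaining_on M T"
  proof cases
    case 1
    then show ?thesis using dec M by (intro AM_decomposition_attaining_below)
  next
    case (2 x)
    define u where "u = inverse (norm x) *\<^sub>R x"
    have u: "u \<in> M" "norm u = 1" "F u = 0"
      using 2 csubspace_imp_subspace[OF M(1)]
      by (simp_all add: u_def subspace_scale linear_scale[OF bounded_clinearD(2)[OF F(1)]])
    then have "norm (T u) \<le> min_modulus_on M T"
      using AM_decomposition_norm_le[OF dec, of u] 2 by simp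
    then show ?thesis
      using u min_modulus_on_le by (intro min_attaining_onI) (auto intro: order_trans)
  next
    case 3
    \<comment> \<open>The injective \<open>F\<close> maps a Hamel basis \<open>B\<close> of
      \<open>M\<close> to an independent set inside its finite-dimensional range, so
      \<open>B\<close> is finite.\<close>
    obtain C where C: "finite C" "cspan C = range F"
      using F(2) by (auto simp: finite_rank_op_def cfinite_dim_def)
    obtain B where B: "B \<subseteq> M" "complex_vector.independent B" "M \<subseteq> cspan B"
      using complex_vector.maximal_independent_subset by blast
    have span: "cspan B = M"
      using B complex_vector.span_minimal[OF B(1) M(1)] by blast
    interpret F: Vector_Spaces.linear scaleC scaleC F
      rewrites "module.subspace scaleC = csubspace" and "module.span scaleC = cspan"
      using bounded_clinear_imp_clinear[OF F(1)] by (simp_all add: csubspace_def cspan_def)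
    have inj: "inj_on F (cspan B)"
      unfolding F.inj_on_iff_eq_0[OF complex_vector.subspace_span] using 3 span by blast
    have "complex_vector.independent (F ` B)"
      using F.independent_injective_image[OF B(2) inj] .
    then have "finite (F ` B)"
      using complex_vector.independent_span_bound[OF C(1)] C(2) by blast
    moreover have "inj_on F B"
      using inj complex_vector.span_superset by (rule inj_on_subset)
    ultimately have "finite B" using finite_image_iff by blast
    then show ?thesis using T M span by (intro min_attaining_on_finite_dim) auto
  qed
qed

section \<open>Uniqueness of the decomposition\<close>

text \<open>An infinite orthonormal set yields a sequence with mutual distances sqrt 2, which has no
  Cauchy subsequence.\<close>

lemma not_compact_cball:
  assumes "\<not> cfinite_dim (UNIV :: 'a::complex_inner set)"
  shows "\<not> compact (cball (0::'a) 1)"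
proof
  assume comp: "compact (cball (0::'a) 1)"
  obtain E :: "'a set" where E: "orthonormal E"
    and max: "\<And>x. \<lbrakk>x \<in> UNIV; norm x = 1; \<forall>e\<in>E. cinner x e = 0\<rbrakk> \<Longrightarrow> False"
    using maximal_orthonormal_subset by blast
  have "x = 0" if x: "\<forall>e\<in>E. cinner x e = 0" for x
  proof (rule ccontr)
    assume "x \<noteq> 0"
    then show False
      using max[of "inverse (norm x) *\<^sub>R x"] x by (simp add: cinner_scaleR_left)
  qed
  then have "infinite E" using total_orthonormal_infinite E assms by blast
  then obtain f :: "nat \<Rightarrow> 'a" where f: "inj f" "range f \<subseteq> E"
    using infinite_countable_subset by blast
  have fE: "f n \<in> E" for n using f by blast
  have "\<forall>n. f n \<in> cball 0 1" using fE E by (simp add: orthonormal_norm)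
  then obtain l r where r: "strict_mono r" "(f \<circ> r) \<longlonglongrightarrow> l"
    using comp unfolding compact_def by blast
  have "Cauchy (f \<circ> r)" using r(2) by (rule LIMSEQ_imp_Cauchy)
  then obtain N where N: "\<And>i j. i \<ge> N \<Longrightarrow> j \<ge> N \<Longrightarrow> dist ((f \<circ> r) i) ((f \<circ> r) j) < 1"
    using metric_CauchyD[of "f \<circ> r" 1] by auto
  define a b where "a = f (r N)" and "b = f (r (Suc N))"
  have "a \<noteq> b"
    using f(1) r(1) by (simp add: a_def b_def inj_eq strict_mono_eq)
  moreover have ab: "a \<in> E" "b \<in> E" by (simp_all add: a_def b_def fE)
  ultimately have "orthogonal a b"
    using E by (intro cinner_eq_0_imp_orthogonal) (simp add: orthonormal_cinner)
  then have "(norm (a - b))\<^sup>2 = (norm a)\<^sup>2 + (norm b)\<^sup>2"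
    unfolding power2_norm_eq_inner
    by (simp add: orthogonal_def inner_diff_left inner_diff_right inner_commute)
  then have "(norm (a - b))\<^sup>2 = 2" using ab E by (simp add: orthonormal_norm)
  moreover have "norm (a - b) < 1" using N[of N "Suc N"] by (simp add: a_def b_def dist_norm)
  then have "(norm (a - b))\<^sup>2 < 1" by (simp add: power_less_one_iff)
  ultimately show False by simp
qed

text \<open>Subtracting the decompositions writes (\<alpha> - \<alpha>') \<open>x\<close> as
  \<open>(K x - F x) - (K' x - F' x)\<close>. If \<alpha> \<noteq> \<alpha>', the unit ball lies in
  a continuous image of a product of four compact sets.\<close>

lemma AM_decomposition_scalar_unique:
  fixes T :: "'a::chilbert_space \<Rightarrow> 'a"
  assumes inf: "\<not> cfinite_dim (UNIV :: 'a set)"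
    and dec: "AM_decomposition T \<alpha> K F" "AM_decomposition T \<alpha>' K' F'"
  shows "\<alpha> = \<alpha>'"
proof (rule ccontr)
  assume "\<alpha> \<noteq> \<alpha>'"
  define d where "d = \<alpha> - \<alpha>'"
  have "d \<noteq> 0" using \<open>\<alpha> \<noteq> \<alpha>'\<close> by (simp add: d_def)
  let ?c = "\<lambda>S :: 'a \<Rightarrow> 'a. closure (S ` cball 0 1)"
  have c: "compact (?c K)" "compact (?c F)" "compact (?c K')" "compact (?c F')"
    using dec finite_rank_imp_compact_op[of F] finite_rank_imp_compact_op[of F']
    by (auto simp: AM_decomposition_def compact_op_def)
  have m: "S x \<in> ?c S" if "x \<in> cball 0 1" for S :: "'a \<Rightarrow> 'a" and x
    by (rule subsetD[OF closure_subset imageI[OF that]])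
  define g where "g = (\<lambda>(k, f, k', f'). inverse d *\<^sub>R ((k - f) - (k' - f')) :: 'a)"
  have comp: "compact (g ` (?c K \<times> ?c F \<times> ?c K' \<times> ?c F'))"
    unfolding g_def case_prod_unfold
    by (intro compact_continuous_image compact_Times c continuous_intros)
  have "cball 0 1 \<subseteq> g ` (?c K \<times> ?c F \<times> ?c K' \<times> ?c F')"
  proof
    fix x :: 'a assume x: "x \<in> cball 0 1"
    have "K x - F x = \<alpha> *\<^sub>R x - T x" "K' x - F' x = \<alpha>' *\<^sub>R x - T x"
      using AM_decomposition_diff[OF dec(1), of x] AM_decomposition_diff[OF dec(2), of x]
      by simp_all
    then have "(K x - F x) - (K' x - F' x) = d *\<^sub>R x"
      by (simp add: d_def scaleR_diff_left)
    then have "x = g (K x, F x, K' x, F' x)"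
      using \<open>d \<noteq> 0\<close> by (simp add: g_def)
    then show "x \<in> g ` (?c K \<times> ?c F \<times> ?c K' \<times> ?c F')"
      using m[OF x] by blast
  qed
  then have "compact (cball (0::'a) 1)"
    using compact_Int_closed[OF comp closed_cball, of 0 1] by (simp add: Int_absorb1)
  then show False using not_compact_cball[OF inf] by blast
qed

text \<open>If \<open>D = K - K' = F - F'\<close> had a positive number \<open>d\<close> as supremum of its form, then on an
  approximate eigenvector \<open>x\<close> for \<open>d\<close> the relation
  \<open>0 = \<langle>F x, K x\<rangle> = \<langle>F' x + D x, K' x + D x\<rangle>\<close> would force \<open>\<parallel>D x\<parallel>\<close> to be small.\<close>

lemma orthogonal_positive_difference_le:
  fixes K F K' F' :: "'a::complex_inner \<Rightarrow> 'a"
  assumes bl: "bounded_clinear K" "bounded_clinear F" "bounded_clinear K'" "bounded_clinear F'"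
    and pos: "positive_op K" "positive_op F" "positive_op K'" "positive_op F'"
    and KF: "\<And>x. K (F x) = 0" "\<And>x. K' (F' x) = 0"
    and eq: "\<And>x. K x - F x = K' x - F' x"
  shows "inner (K x) x \<le> inner (K' x) x"
proof (rule ccontr)
  assume "\<not> inner (K x) x \<le> inner (K' x) x"
  define D where "D = (\<lambda>x. K x - K' x)"
  have D_bl: "bounded_clinear D" unfolding D_def by (intro bounded_clinear_diff bl)
  have D_lin: "linear D" using bounded_clinearD[OF D_bl] by blast
  have D_F: "F y = F' y + D y" "K y = K' y + D y" for y
    using eq[of y] by (simp_all add: D_def algebra_simps)
  have sym: "inner (S u) v = inner u (S v)" if "S \<in> {K, F, K', F'}" for S u v
    using that bl pos positive_op_inner_symmetric by blast
  have D_sym: "inner (D u) v = inner u (D v)" for u v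
    using sym[of K u v] sym[of K' u v] by (simp add: D_def inner_diff_left inner_diff_right)
  obtain b where b: "\<And>y. norm (D y) \<le> norm y * b" "b \<ge> 0"
    using bounded_linear.nonneg_bounded[OF bounded_clinearD(1)[OF D_bl]] by blast
  obtain k where k: "\<And>y. norm (K' y) \<le> norm y * k" "k \<ge> 0"
    using bounded_linear.nonneg_bounded[OF bounded_clinearD(1)[OF bl(3)]] by blast
  obtain f where f: "\<And>y. norm (F' y) \<le> norm y * f" "f \<ge> 0"
    using bounded_linear.nonneg_bounded[OF bounded_clinearD(1)[OF bl(4)]] by blast
  \<comment> \<open>The values of the form of \<open>D\<close> on the unit sphere; their supremum
    \<open>d\<close> is positive because the form is positive at \<open>x\<close>.\<close>
  define V where "V = {inner (D y) y | y. norm y = 1}"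
  define d where "d = Sup V"
  have bdd: "bdd_above V"
  proof (rule bdd_aboveI)
    fix v assume "v \<in> V"
    then obtain y where y: "v = inner (D y) y" "norm y = 1" unfolding V_def by blast
    then have "v \<le> norm (D y) * norm y" using norm_cauchy_schwarz[of "D y" y] by simp
    then show "v \<le> b" using b(1)[of y] y by simp
  qed
  have upper: "inner (D y) y \<le> d * (norm y)\<^sup>2" for y
  proof (cases "y = 0")
    case False
    define w where "w = inverse (norm y) *\<^sub>R y"
    have "norm w = 1" using False by (simp add: w_def)
    then have "inner (D w) w \<le> d" unfolding d_def using bdd by (intro cSup_upper) (auto simp: V_def)
    moreover have "inner (D w) w = inner (D y) y / (norm y)\<^sup>2"
      by (simp add: w_def linear_scale[OF D_lin] power2_eq_square divide_inverse)
    ultimately show ?thesis using False by (simp add: pos_divide_le_eq)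
  qed (simp add: linear_0[OF D_lin])
  have "0 < inner (D x) x"
    using \<open>\<not> inner (K x) x \<le> inner (K' x) x\<close> by (simp add: D_def inner_diff_left)
  then have "0 < d * (norm x)\<^sup>2" using upper[of x] by linarith
  then have "d > 0" by (simp add: zero_less_mult_iff)
  have "x \<noteq> 0" using \<open>0 < inner (D x) x\<close> by auto
  have V_ne: "V \<noteq> {}"
    using \<open>x \<noteq> 0\<close> unfolding V_def
    by (auto intro!: exI[of _ "inverse (norm x) *\<^sub>R x"])
  \<comment> \<open>By the choice of \<open>d\<close> the form of \<open>R\<close> is nonnegative,
    so \<open>norm_sq_le_form\<close> makes \<open>R y\<close> small wherever
    \<open>inner (D y) y\<close> is close to \<open>d\<close> on the unit sphere.\<close>
  define R where "R = (\<lambda>y. d *\<^sub>R y - D y)"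
  have R_norm: "norm (R y) \<le> (d + b) * norm y" for y
    using norm_triangle_ineq4[of "d *\<^sub>R y" "D y"] b(1)[of y] \<open>d > 0\<close>
    by (simp add: R_def algebra_simps)
  have R_lin: "linear R"
    unfolding R_def using bounded_clinear_diff[OF bounded_clinear_scaleR D_bl]
    by (rule bounded_clinearD)
  have R_sq: "(norm (R y))\<^sup>2 \<le> (d + b) * inner (R y) y" for y
  proof (rule norm_sq_le_form[of R UNIV])
    show "inner (R u) v = inner u (R v)" for u v
      by (simp add: R_def inner_diff_left inner_diff_right D_sym)
    show "0 \<le> inner (R u) u" for u
      using upper[of u] by (simp add: R_def inner_diff_left power2_norm_eq_inner)
  qed (use R_lin R_norm in auto)
  \<comment> \<open>The condition \<epsilon> < d/2 keeps \<open>norm (D y)\<close> at or above d/2,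
    the origin of \<open>d\<^sup>2 / 4\<close>.\<close>
  have main: "d\<^sup>2 / 4 \<le> (f + k) * sqrt ((d + b) * \<epsilon>)" if \<epsilon>: "0 < \<epsilon>" "\<epsilon> < d / 2" for \<epsilon>
  proof -
    obtain y where y: "norm y = 1" "d - \<epsilon> < inner (D y) y"
      using less_cSupD[OF V_ne, of "d - \<epsilon>"] \<epsilon> by (auto simp: d_def V_def)
    have "(d + b) * inner (R y) y \<le> (d + b) * \<epsilon>"
      using y \<open>d > 0\<close> b(2)
      by (intro mult_left_mono) (auto simp: R_def inner_diff_left power2_norm_eq_inner[symmetric])
    then have "(norm (R y))\<^sup>2 \<le> (d + b) * \<epsilon>" using R_sq[of y] by linarith
    then have Ry: "norm (R y) \<le> sqrt ((d + b) * \<epsilon>)" by (rule real_le_rsqrt)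
    have "inner (F y) (K y) = 0" using KF(1)[of y] sym[of K "F y" y] sym[of K y "F y"]
      by (simp add: inner_commute)
    moreover have "inner (F' y) (K' y) = 0"
      using KF(2)[of y] sym[of K' "F' y" y] by simp
    \<comment> \<open>Expansion of \<open>inner (F y) (K y) = 0\<close> with
      \<open>F = F' + D\<close> and \<open>K = K' + D\<close>.\<close>
    ultimately have "0 = inner (F' y) (D y) + inner (D y) (K' y) + (norm (D y))\<^sup>2"
      unfolding D_F power2_norm_eq_inner by (simp add: inner_add_left inner_add_right)
    moreover have Dy: "D y = d *\<^sub>R y - R y" by (simp add: R_def)
    moreover have "inner (F' y) (D y) = d * inner (F' y) y - inner (F' y) (R y)"
      "inner (D y) (K' y) = d * inner (K' y) y - inner (R y) (K' y)"
      unfolding Dy by (simp_all add: inner_diff_left inner_diff_right inner_commute)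
    ultimately have "(norm (D y))\<^sup>2 = inner (F' y) (R y) + inner (R y) (K' y)
        - d * inner (F' y) y - d * inner (K' y) y"
      by linarith
    moreover have "0 \<le> d * inner (F' y) y" "0 \<le> d * inner (K' y) y"
      using \<open>d > 0\<close> positive_op_form_nonneg[OF pos(3), of y] positive_op_form_nonneg[OF pos(4), of y]
      by simp_all
    moreover have "inner (F' y) (R y) \<le> f * norm (R y)"
      using norm_cauchy_schwarz[of "F' y" "R y"] f(1)[of y] y(1)
        mult_right_mono[of "norm (F' y)" f "norm (R y)"] by simp
    moreover have "inner (R y) (K' y) \<le> k * norm (R y)"
      using norm_cauchy_schwarz[of "K' y" "R y"] k(1)[of y] y(1)
        mult_right_mono[of "norm (K' y)" k "norm (R y)"] by (simp add: inner_commute)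
    ultimately have "(norm (D y))\<^sup>2 \<le> (f + k) * norm (R y)"
      by (simp add: algebra_simps)
    also have "\<dots> \<le> (f + k) * sqrt ((d + b) * \<epsilon>)"
      using Ry f k by (intro mult_left_mono) auto
    finally have up: "(norm (D y))\<^sup>2 \<le> (f + k) * sqrt ((d + b) * \<epsilon>)" .
    have "d / 2 \<le> norm (D y)"
      using y \<epsilon> norm_cauchy_schwarz[of "D y" y] by simp
    then have "(d / 2)\<^sup>2 \<le> (norm (D y))\<^sup>2" using \<open>d > 0\<close> by (intro power_mono) auto
    then show ?thesis using up by (simp add: power_divide)
  qed
  \<comment> \<open>The left side of \<open>main\<close> does not depend on \<epsilon>, so letting
    \<epsilon> tend to 0 from the right gives d^2/4 \<le> 0.\<close>
  have "eventually (\<lambda>\<epsilon>. d\<^sup>2 / 4 \<le> (f + k) * sqrt ((d + b) * \<epsilon>)) (at_right 0)"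
    using eventually_at_right_less[of 0] eventually_at_right_real[of 0 "d / 2"] \<open>d > 0\<close> main
    by (auto elim: eventually_mono)
  moreover have "((\<lambda>\<epsilon>. (f + k) * sqrt ((d + b) * \<epsilon>)) \<longlongrightarrow> (f + k) * sqrt ((d + b) * 0)) (at_right 0)"
    by (intro tendsto_intros)
  ultimately have "d\<^sup>2 / 4 \<le> (f + k) * sqrt ((d + b) * 0)"
    by (intro tendsto_lowerbound) auto
  then show False using \<open>d > 0\<close> by simp
qed

lemma AM_decomposition_unique:
  fixes T :: "'a::chilbert_space \<Rightarrow> 'a"
  assumes inf: "\<not> cfinite_dim (UNIV :: 'a set)"
    and dec: "AM_decomposition T \<alpha> K F" "AM_decomposition T \<alpha>' K' F'"
  shows "\<alpha> = \<alpha>' \<and> K = K' \<and> F = F'"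
proof -
  have \<alpha>: "\<alpha> = \<alpha>'" using assms by (rule AM_decomposition_scalar_unique)
  have 1: "bounded_clinear K" "bounded_clinear F" "bounded_clinear K'" "bounded_clinear F'"
    "positive_op K" "positive_op F" "positive_op K'" "positive_op F'"
    "\<And>x. K (F x) = 0" "\<And>x. K' (F' x) = 0"
    using dec by (auto simp: AM_decomposition_def fun_eq_iff)
  have "K x - F x = \<alpha> *\<^sub>R x - T x" "K' x - F' x = \<alpha> *\<^sub>R x - T x" for x
    using AM_decomposition_diff[OF dec(1), of x] AM_decomposition_diff[OF dec(2), of x] \<alpha>
    by simp_all
  then have eq: "K x - F x = K' x - F' x" for x by metis
  define D where "D = (\<lambda>x. K x - K' x)"
  have D: "bounded_clinear D" unfolding D_def using 1 by (intro bounded_clinear_diff)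
  have sym: "inner (D x) y = inner x (D y)" for x y
    using positive_op_inner_symmetric[OF 1(1,5)] positive_op_inner_symmetric[OF 1(3,7)]
    by (simp add: D_def inner_diff_left inner_diff_right)
  \<comment> \<open>The comparison applies in both directions. A symmetric operator whose form
    vanishes identically is zero, which gives \<open>K = K'\<close>.\<close>
  have "inner (K x) x = inner (K' x) x" for x
    using orthogonal_positive_difference_le[of K F K' F' x]
      orthogonal_positive_difference_le[of K' F' K F x] 1 eq by (metis order_antisym)
  then have form: "inner (D x) x = 0" for x by (simp add: D_def inner_diff_left)
  have "D x = 0" for x
  proof -
    have "(norm (D x))\<^sup>2 \<le> onorm D * inner (D x) x"
      using bounded_clinearD[OF D] sym form onorm[OF bounded_clinearD(1)[OF D]]
      by (intro norm_sq_le_form[of D UNIV]) auto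
    then show ?thesis by (simp add: form)
  qed
  then have "K = K'" by (simp add: D_def fun_eq_iff)
  then show ?thesis using \<alpha> eq by (auto simp: fun_eq_iff)
qed

section \<open>Absolutely minimum attaining positive operators\<close>

text \<open>On \<open>M\<close> the form of T^2 - m^2 is nonnegative, and it is zero at a minimizer
  \<open>x\<close>; hence T^2 x = m^2 x. Factoring as (T - m)(T + m) x = 0 leaves two candidates:
  \<open>x\<close> itself with eigenvalue -m, or \<open>w\<close> = (T + m) x with eigenvalue
  m.\<close>

lemma abs_min_attaining_eigenvector:
  assumes T: "bounded_clinear T" "\<And>x y. cinner (T x) y = cinner x (T y)" "abs_min_attaining T"
    and M: "csubspace M" "closed M" "M \<noteq> {0}" "\<And>x. x \<in> M \<Longrightarrow> T x \<in> M"
  shows "\<exists>x\<in>M. norm x = 1 \<and> (\<exists>r. T x = r *\<^sub>R x)"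
proof -
  have sub: "subspace M" using M by (simp add: csubspace_imp_subspace)
  have lin: "linear T" using bounded_clinearD[OF T(1)] by blast
  have sym: "inner (T x) y = inner x (T y)" for x y by (rule inner_symmetricI) (rule T(2))
  define m where "m = min_modulus_on M T"
  obtain x where x: "x \<in> M" "norm x = 1" "norm (T x) = m"
    using T(3) M unfolding abs_min_attaining_def min_attaining_on_def m_def by blast
  have "m \<ge> 0" using x(3) by (metis norm_ge_zero)
  define S where "S = (\<lambda>y. T (T y) - m\<^sup>2 *\<^sub>R y)"
  have form: "inner (S y) y = (norm (T y))\<^sup>2 - m\<^sup>2 * (norm y)\<^sup>2" for y
    by (simp add: S_def inner_diff_left power2_norm_eq_inner sym[of "T y" y])
  have S_bl: "bounded_linear S"
    unfolding S_def using bounded_clinearD(1)[OF T(1)]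
    by (intro bounded_linear_sub bounded_linear_scaleR_right bounded_linear_compose[of T T])
  have "(norm (S x))\<^sup>2 \<le> onorm S * inner (S x) x"
  proof (rule norm_sq_le_form[of S M])
    show "linear S" using S_bl by (rule bounded_linear.linear)
    show "inner (S u) v = inner u (S v)" for u v
      using sym[of "T u" v] sym[of u "T v"] by (simp add: S_def inner_diff_left inner_diff_right)
    show "0 \<le> inner (S u) u" if "u \<in> M" for u
    proof -
      have "(m * norm u)\<^sup>2 \<le> (norm (T u))\<^sup>2"
        using min_modulus_on_mult_le[OF lin sub that] \<open>m \<ge> 0\<close>
        by (intro power_mono) (auto simp: m_def)
      then show ?thesis by (simp add: form power_mult_distrib)
    qed
    show "norm (S u) \<le> onorm S * norm u" for u using S_bl by (rule onorm)
    show "S x \<in> M" unfolding S_def using sub M(4) x by (intro subspace_diff subspace_scale) auto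
  qed (use sub x in auto)
  then have "S x = 0" by (simp add: form x)
  then have TT: "T (T x) = m\<^sup>2 *\<^sub>R x" by (simp add: S_def)
  define w where "w = T x + m *\<^sub>R x"
  show ?thesis
  proof (cases "w = 0")
    case True
    then have "T x = (- m) *\<^sub>R x" by (simp add: w_def add_eq_0_iff2)
    then show ?thesis using x by blast
  next
    case False
    have "T w = m *\<^sub>R w"
      by (simp add: w_def linear_add[OF lin] linear_scale[OF lin] TT power2_eq_square scaleR_add_right)
    then have "T (inverse (norm w) *\<^sub>R w) = m *\<^sub>R (inverse (norm w) *\<^sub>R w)"
      by (simp add: linear_scale[OF lin])
    moreover have "inverse (norm w) *\<^sub>R w \<in> M"
      unfolding w_def using sub M(4) x by (intro subspace_scale subspace_add) auto
    moreover have "norm (inverse (norm w) *\<^sub>R w) = 1" using False by simp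
    ultimately show ?thesis by blast
  qed
qed

text \<open>The obstruction to being absolutely minimum attaining: on the closed span of \<open>S\<close> the
  infimum is \<open>\<gamma>\<close>, and a minimizer would be orthogonal to all of \<open>S\<close>.\<close>

lemma not_abs_min_attaining:
  fixes T :: "'a::complex_inner \<Rightarrow> 'b::complex_inner"
  assumes T: "bounded_clinear T" and S: "orthonormal S" "S \<noteq> {}"
    and orth: "\<And>e f. \<lbrakk>e \<in> S; f \<in> S; e \<noteq> f\<rbrakk> \<Longrightarrow> cinner (T e) (T f) = 0"
    and "\<gamma> \<ge> 0" and above: "\<And>e. e \<in> S \<Longrightarrow> \<gamma> < norm (T e)"
    and approx: "\<And>\<epsilon>. \<epsilon> > 0 \<Longrightarrow> \<exists>e\<in>S. norm (T e) < \<gamma> + \<epsilon>"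
  shows "\<not> abs_min_attaining T"
proof
  assume AM: "abs_min_attaining T"
  have lin: "linear T" using bounded_clinearD[OF T] by blast
  define M where "M = closure (cspan S)"
  have S_M: "e \<in> M" if "e \<in> S" for e
    unfolding M_def using that complex_vector.span_base closure_subset by blast
  have "csubspace M" "closed M"
    by (simp_all add: M_def csubspace_closure complex_vector.subspace_span)
  moreover have "M \<noteq> {0}"
  proof -
    obtain e where "e \<in> S" using S by blast
    then have "e \<in> M" "norm e = 1" using S_M S orthonormal_norm by blast+
    then show ?thesis by auto
  qed
  ultimately obtain x where x: "x \<in> M" "norm x = 1" "norm (T x) = min_modulus_on M T"
    using AM unfolding abs_min_attaining_def min_attaining_on_def by blast
  have "norm (T x) \<le> \<gamma>"
  proof (rule field_le_epsilon)
    fix \<epsilon> :: real assume "\<epsilon> > 0"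
    then obtain e where e: "e \<in> S" "norm (T e) < \<gamma> + \<epsilon>" using approx by blast
    then have "min_modulus_on M T \<le> norm (T e)"
      using S S_M by (intro min_modulus_on_le) (auto simp: orthonormal_norm)
    then show "norm (T x) \<le> \<gamma> + \<epsilon>" using e x by simp
  qed
  then have Tx: "(norm (T x))\<^sup>2 \<le> \<gamma>\<^sup>2" by (intro power_mono) auto
  have "cinner x f = 0" if f: "f \<in> S" for f
  proof -
    define a where "a = (norm (T f))\<^sup>2 - \<gamma>\<^sup>2"
    have "a > 0" using above[OF f] \<open>\<gamma> \<ge> 0\<close> by (simp add: a_def power_strict_mono)
    \<comment> \<open>In the Pythagorean expansion all summands are nonnegative, so the one
      belonging to \<open>f\<close> is bounded by the total. The estimate is closed in
      \<open>y\<close> and so reaches the minimizer \<open>x\<close>, where the right side is at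
      most 0.\<close>
    have span: "a * (cmod (cinner y f))\<^sup>2 \<le> (norm (T y))\<^sup>2 - \<gamma>\<^sup>2 * (norm y)\<^sup>2"
      if "y \<in> cspan S" for y
    proof -
      obtain A c where A: "finite A" "A \<subseteq> S" and y: "y = (\<Sum>e\<in>A. c e *\<^sub>C e)"
        using \<open>y \<in> cspan S\<close> unfolding complex_vector.span_explicit by blast
      have on: "orthonormal A" using S(1) A(2) by (rule orthonormal_subset)
      have "T y = (\<Sum>e\<in>A. c e *\<^sub>C T e)"
        unfolding y by (simp add: linear_sum[OF lin] bounded_clinearD(3)[OF T])
      then have "(norm (T y))\<^sup>2 = (\<Sum>e\<in>A. (cmod (c e))\<^sup>2 * (norm (T e))\<^sup>2)"
        using A orth by (simp add: norm_orthogonal_combination subset_iff)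
      moreover have "(norm y)\<^sup>2 = (\<Sum>e\<in>A. (cmod (c e))\<^sup>2)"
        unfolding y using on A(1) by (rule norm_orthonormal_combination)
      ultimately have eq: "(norm (T y))\<^sup>2 - \<gamma>\<^sup>2 * (norm y)\<^sup>2
          = (\<Sum>e\<in>A. ((norm (T e))\<^sup>2 - \<gamma>\<^sup>2) * (cmod (c e))\<^sup>2)"
        by (simp add: sum_distrib_left sum_subtractf[symmetric] algebra_simps)
      have nonneg: "0 \<le> ((norm (T e))\<^sup>2 - \<gamma>\<^sup>2) * (cmod (c e))\<^sup>2" if "e \<in> A" for e
      proof -
        have "\<gamma> < norm (T e)" using above that A(2) by blast
        then have "\<gamma>\<^sup>2 \<le> (norm (T e))\<^sup>2" using \<open>\<gamma> \<ge> 0\<close> by (intro power_mono) auto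
        then show ?thesis by simp
      qed
      show ?thesis
      proof (cases "f \<in> A")
        case True
        have "cinner y f = c f" unfolding y using on A(1) True by (rule cinner_orthonormal_sum)
        then show ?thesis
          unfolding eq a_def
          using member_le_sum[of f A "\<lambda>e. ((norm (T e))\<^sup>2 - \<gamma>\<^sup>2) * (cmod (c e))\<^sup>2"] True nonneg A(1)
          by simp
      next
        case False
        have "cinner y f = 0"
          unfolding y using S(1) A(2) f False by (intro cinner_orthonormal_sum_outside) auto
        then show ?thesis unfolding eq using nonneg by (simp add: sum_nonneg)
      qed
    qed
    have "closure (cspan S) \<subseteq> {y. a * (cmod (cinner y f))\<^sup>2 \<le> (norm (T y))\<^sup>2 - \<gamma>\<^sup>2 * (norm y)\<^sup>2}"
    proof (rule closure_minimal)
      show "closed {y. a * (cmod (cinner y f))\<^sup>2 \<le> (norm (T y))\<^sup>2 - \<gamma>\<^sup>2 * (norm y)\<^sup>2}"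
        by (intro closed_Collect_le continuous_intros linear_continuous_on bounded_clinearD(1)[OF T])
    qed (use span in blast)
    then have "a * (cmod (cinner x f))\<^sup>2 \<le> (norm (T x))\<^sup>2 - \<gamma>\<^sup>2 * (norm x)\<^sup>2"
      using x(1) unfolding M_def by blast
    then have "a * (cmod (cinner x f))\<^sup>2 \<le> 0" using Tx x(2) by simp
    then show ?thesis using \<open>a > 0\<close> by (simp add: mult_le_0_iff)
  qed
  then have "cinner x x = 0"
    using x(1) unfolding M_def by (rule cinner_eq_0_closure_cspan)
  then show False using x(2) by (simp add: cinner_self)
qed

section \<open>Cluster values of the eigenvalues\<close>

text \<open>Bolzano-Weierstrass along an injective sequence of indices rather than of values: an
  eigenvalue of infinite multiplicity counts as a cluster value too.\<close>

lemma infinite_bounded_cluster: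
  fixes l :: "'a \<Rightarrow> real"
  assumes "infinite A" "\<And>e. e \<in> A \<Longrightarrow> a \<le> l e \<and> l e \<le> b"
  obtains g :: "nat \<Rightarrow> 'a" and \<beta> where "inj g" "\<And>n. g n \<in> A" "(\<lambda>n. l (g n)) \<longlonglongrightarrow> \<beta>" "a \<le> \<beta>" "\<beta> \<le> b"
proof -
  obtain f :: "nat \<Rightarrow> 'a" where f: "inj f" "range f \<subseteq> A"
    using assms(1) infinite_countable_subset by blast
  then have fA: "f n \<in> A" for n by blast
  then have "\<forall>n. (\<lambda>n. l (f n)) n \<in> {a..b}" using assms(2) by simp
  then obtain \<beta> r where r: "\<beta> \<in> {a..b}" "strict_mono r" "((\<lambda>n. l (f n)) \<circ> r) \<longlonglongrightarrow> \<beta>"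
    using compact_Icc[of a b, unfolded compact_def, THEN spec, of "\<lambda>n. l (f n)"] by auto
  show ?thesis
  proof (rule that[of "f \<circ> r"])
    show "inj (f \<circ> r)" using f(1) r(2) by (intro inj_compose strict_mono_imp_inj_on)
    show "(f \<circ> r) n \<in> A" for n by (simp add: fA)
    show "(\<lambda>n. l ((f \<circ> r) n)) \<longlonglongrightarrow> \<beta>" using r(3) by (simp add: o_def)
  qed (use r(1) in auto)
qed

text \<open>The vectors \<open>g n\<close> realize the obstruction of
  \<open>not_abs_min_attaining\<close> with \<gamma> = \<alpha>, as their eigenvalues approach
  \<alpha> without reaching it.\<close>

lemma no_eigenvalue_cluster_from_above:
  assumes T: "bounded_clinear T" "abs_min_attaining T" and E: "orthonormal E"
    and eig: "\<And>e. e \<in> E \<Longrightarrow> T e = l e *\<^sub>R e"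
    and "inj g" "\<And>n::nat. g n \<in> E" "(\<lambda>n. l (g n)) \<longlonglongrightarrow> \<alpha>"
    and "\<alpha> \<ge> 0" "\<And>n. \<alpha> < l (g n)"
  shows False
proof -
  have norm: "norm (T (g n)) = l (g n)" for n
    using assms(6)[of n] assms(8) assms(9)[of n] E by (simp add: eig orthonormal_norm)
  have "\<not> abs_min_attaining T"
  proof (rule not_abs_min_attaining[OF T(1), of "range g" \<alpha>])
    show "orthonormal (range g)" using E assms(6) by (intro orthonormal_subset[OF E]) auto
    show "cinner (T e) (T f) = 0" if "e \<in> range g" "f \<in> range g" "e \<noteq> f" for e f
    proof -
      have "e \<in> E" "f \<in> E" using that assms(6) by auto
      then show ?thesis
        using E that(3) by (simp add: eig cinner_scaleR_left cinner_scaleR_right orthonormal_cinner)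
    qed
    show "\<alpha> < norm (T e)" if "e \<in> range g" for e using that assms(9) norm by auto
    show "\<exists>e\<in>range g. norm (T e) < \<alpha> + \<epsilon>" if "\<epsilon> > 0" for \<epsilon>
    proof -
      have "eventually (\<lambda>n. l (g n) < \<alpha> + \<epsilon>) sequentially"
        using assms(7) that by (intro order_tendstoD) auto
      then obtain n where "l (g n) < \<alpha> + \<epsilon>" by (auto simp: eventually_sequentially)
      then show ?thesis using norm by auto
    qed
  qed (use assms(8) in auto)
  then show False using T(2) by blast
qed

text \<open>Two different cluster values are impossible: mixing eigenvectors from both clusters produces
  an orthonormal sequence with orthogonal images whose norms decrease to a value in between.\<close>

lemma eigenvalue_cluster_le:
  assumes T: "bounded_clinear T" "abs_min_attaining T" and E: "orthonormal E"
    and eig: "\<And>e. e \<in> E \<Longrightarrow> T e = l e *\<^sub>R e" "\<And>e. e \<in> E \<Longrightarrow> 0 \<le> l e"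
    and g: "inj g" "\<And>n::nat. g n \<in> E" "(\<lambda>n. l (g n)) \<longlonglongrightarrow> \<alpha>"
    and h: "inj h" "\<And>n::nat. h n \<in> E" "(\<lambda>n. l (h n)) \<longlonglongrightarrow> \<beta>"
  shows "\<beta> \<le> \<alpha>"
proof (rule ccontr)
  assume "\<not> \<beta> \<le> \<alpha>"
  \<comment> \<open>The norms of the images will decrease to \<open>c\<close>; the buffer
    \<open>c'\<close> keeps the prescribed values \<open>\<tau> n\<close> below the squared
    eigenvalues near \<beta>.\<close>
  define c where "c = (\<alpha> + \<beta>) / 2"
  define c' where "c' = (c + \<beta>) / 2"
  have "\<alpha> \<ge> 0" using LIMSEQ_le_const[OF g(3)] eig(2) g(2) by blast
  then have c: "\<alpha> < c" "c < c'" "c' < \<beta>" "0 < c"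
    using \<open>\<not> \<beta> \<le> \<alpha>\<close> by (simp_all add: c_def c'_def)
  have "eventually (\<lambda>n. l (g n) < c \<and> c' < l (h n)) sequentially"
    using order_tendstoD(2)[OF g(3) c(1)] order_tendstoD(1)[OF h(3) c(3)] by (rule eventually_conj)
  then obtain N where N: "\<And>n. n \<ge> N \<Longrightarrow> l (g n) < c \<and> c' < l (h n)"
    unfolding eventually_sequentially by blast
  define u v where "u = (\<lambda>n. g (n + N))" and "v = (\<lambda>n. h (n + N))"
  have uE: "u n \<in> E" and vE: "v n \<in> E" for n by (simp_all add: u_def v_def g h)
  have lu: "0 \<le> l (u n)" "l (u n) < c" and lv: "c' < l (v n)" for n
    using N[of "n + N"] eig(2)[OF uE] by (simp_all add: u_def v_def)
  \<comment> \<open>\<open>g\<close> and \<open>h\<close> may share vectors; after the shift their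
    eigenvalues lie on different sides of the gap from \<open>c\<close> to
    \<open>c'\<close>.\<close>
  have "u n \<noteq> v m" for n m using lu[of n] lv[of m] c by auto
  then have uv: "cinner (u n) (v m) = 0" for n m
    using orthonormal_cinner[OF E uE vE] by simp
  have on: "cinner (u n) (u m) = (if n = m then 1 else 0)" "cinner (v n) (v m) = (if n = m then 1 else 0)"
    "cinner (u n) (v m) = 0" "cinner (v m) (u n) = 0" for n m
    using orthonormal_cinner[OF E uE[of n] uE[of m]] orthonormal_cinner[OF E vE[of n] vE[of m]]
      uv[of n m] cinner_eq_0_commute[of "u n" "v m"] inj_eq[OF g(1)] inj_eq[OF h(1)]
    by (simp_all add: u_def v_def)
  \<comment> \<open>The prescribed squared norms of the images: they start at
    \<open>c'\<^sup>2\<close> for \<open>n = 0\<close> and decrease to \<open>c\<^sup>2\<close>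
    without reaching it.\<close>
  define \<tau> where "\<tau> = (\<lambda>n. c\<^sup>2 + (c'\<^sup>2 - c\<^sup>2) * inverse (real (Suc n)))"
  have cc: "c\<^sup>2 < c'\<^sup>2" using c by (intro power_strict_mono) auto
  have \<tau>: "c\<^sup>2 < \<tau> n" "\<tau> n \<le> c'\<^sup>2" for n
  proof -
    show "c\<^sup>2 < \<tau> n" using cc by (simp add: \<tau>_def)
    have "(c'\<^sup>2 - c\<^sup>2) * inverse (real (Suc n)) \<le> (c'\<^sup>2 - c\<^sup>2) * 1"
      using cc by (intro mult_left_mono) (auto simp: inverse_le_1_iff)
    then show "\<tau> n \<le> c'\<^sup>2" by (simp add: \<tau>_def)
  qed
  have sq: "(l (u n))\<^sup>2 < c\<^sup>2" "c'\<^sup>2 < (l (v n))\<^sup>2" for n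
    using lu[of n] lv[of n] c by (auto intro!: power_strict_mono)
  \<comment> \<open>The convex weight that interpolates the two squared eigenvalues to
    \<open>\<tau> n\<close>; its square roots as coefficients keep \<open>x n\<close> a unit
    vector.\<close>
  define t where "t = (\<lambda>n. (\<tau> n - (l (u n))\<^sup>2) / ((l (v n))\<^sup>2 - (l (u n))\<^sup>2))"
  have t: "0 \<le> t n" "t n \<le> 1" and t\<tau>: "(1 - t n) * (l (u n))\<^sup>2 + t n * (l (v n))\<^sup>2 = \<tau> n" for n
  proof -
    have pos: "0 < (l (v n))\<^sup>2 - (l (u n))\<^sup>2" using sq[of n] cc by linarith
    show "0 \<le> t n" "t n \<le> 1" using sq[of n] \<tau>[of n] pos by (simp_all add: t_def)
    have "t n * ((l (v n))\<^sup>2 - (l (u n))\<^sup>2) = \<tau> n - (l (u n))\<^sup>2" using pos by (simp add: t_def)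
    then show "(1 - t n) * (l (u n))\<^sup>2 + t n * (l (v n))\<^sup>2 = \<tau> n" by (simp add: algebra_simps)
  qed
  define x where "x = (\<lambda>n. sqrt (1 - t n) *\<^sub>R u n + sqrt (t n) *\<^sub>R v n)"
  have Tx: "T (x n) = (sqrt (1 - t n) * l (u n)) *\<^sub>R u n + (sqrt (t n) * l (v n)) *\<^sub>R v n" for n
    by (simp add: x_def linear_add[OF bounded_clinearD(2)[OF T(1)]]
        linear_scale[OF bounded_clinearD(2)[OF T(1)]] eig(1) uE vE)
  have combination: "cinner (a *\<^sub>R u n + b *\<^sub>R v n) (a' *\<^sub>R u m + b' *\<^sub>R v m)
      = (if n = m then of_real (a * a' + b * b') else 0)" for a b a' b' n m
    by (simp add: cinner_add_left cinner_add_right cinner_scaleR_left cinner_scaleR_right on)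
  have norm_sq: "(norm (a *\<^sub>R u n + b *\<^sub>R v n))\<^sup>2 = a\<^sup>2 + b\<^sup>2" for a b n
  proof -
    have "complex_of_real ((norm (a *\<^sub>R u n + b *\<^sub>R v n))\<^sup>2) = complex_of_real (a\<^sup>2 + b\<^sup>2)"
      unfolding cinner_self[symmetric] combination by (simp add: power2_eq_square)
    then show ?thesis using of_real_eq_iff by blast
  qed
  have x_on: "cinner (x n) (x m) = 0" "cinner (T (x n)) (T (x m)) = 0" if "n \<noteq> m" for n m
    unfolding Tx using that by (simp_all only: x_def combination if_False)
  have x_norm: "norm (x n) = 1" for n
  proof -
    have "(norm (x n))\<^sup>2 = 1" unfolding x_def norm_sq using t[of n] by simp
    then show ?thesis using power2_eq_iff_nonneg[of "norm (x n)" 1] by simp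
  qed
  have Tx_norm: "norm (T (x n)) = sqrt (\<tau> n)" for n
  proof -
    have "(norm (T (x n)))\<^sup>2 = \<tau> n"
      unfolding Tx norm_sq using t[of n] t\<tau>[of n] by (simp add: power_mult_distrib)
    then show ?thesis using real_sqrt_abs[of "norm (T (x n))"] by simp
  qed
  have "\<not> abs_min_attaining T"
  proof (rule not_abs_min_attaining[OF T(1), of "range x" c])
    have distinct: "\<exists>n m. e = x n \<and> f = x m \<and> n \<noteq> m" if "e \<in> range x" "f \<in> range x" "e \<noteq> f" for e f
      using that by auto
    show "orthonormal (range x)"
      unfolding orthonormal_def
    proof (intro conjI ballI impI)
      show "norm e = 1" if "e \<in> range x" for e using that x_norm by auto
      show "cinner e f = 0" if "e \<in> range x" "f \<in> range x" "e \<noteq> f" for e f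
        using distinct[OF that] x_on(1) by auto
    qed
    show "cinner (T e) (T f) = 0" if "e \<in> range x" "f \<in> range x" "e \<noteq> f" for e f
      using distinct[OF that] x_on(2) by auto
    show "c < norm (T e)" if "e \<in> range x" for e
      using that \<tau>(1) by (auto simp: Tx_norm intro!: real_less_rsqrt)
    show "\<exists>e\<in>range x. norm (T e) < c + \<epsilon>" if "\<epsilon> > 0" for \<epsilon>
    proof -
      have "\<tau> \<longlonglongrightarrow> c\<^sup>2 + (c'\<^sup>2 - c\<^sup>2) * 0"
        unfolding \<tau>_def by (intro tendsto_intros LIMSEQ_inverse_real_of_nat)
      then have "(\<lambda>n. sqrt (\<tau> n)) \<longlonglongrightarrow> sqrt (c\<^sup>2)" using tendsto_real_sqrt by fastforce
      then have "(\<lambda>n. sqrt (\<tau> n)) \<longlonglongrightarrow> c" using c by simp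
      then have "eventually (\<lambda>n. sqrt (\<tau> n) < c + \<epsilon>) sequentially"
        using that by (intro order_tendstoD) auto
      then obtain n where "sqrt (\<tau> n) < c + \<epsilon>" by (auto simp: eventually_sequentially)
      then show ?thesis using Tx_norm by auto
    qed
  qed (use c in auto)
  then show False using T(2) by blast
qed

section \<open>Diagonal operators\<close>

text \<open>Pythagoras gives the bound on finite combinations of eigenvectors; both sides are
  continuous, so density extends it.\<close>

lemma diagonal_norm_le:
  fixes R :: "'a::complex_inner \<Rightarrow> 'a"
  assumes R: "bounded_clinear R" and E: "orthonormal E" "closure (cspan E) = UNIV"
    and eig: "\<And>e. e \<in> E \<Longrightarrow> R e = \<kappa> e *\<^sub>R e" "\<And>e. e \<in> E \<Longrightarrow> \<bar>\<kappa> e\<bar> \<le> c" and "c \<ge> 0"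
  shows "norm (R x) \<le> c * norm x"
proof -
  have span: "norm (R y) \<le> c * norm y" if "y \<in> cspan E" for y
  proof -
    obtain A z where A: "finite A" "A \<subseteq> E" and y: "y = (\<Sum>e\<in>A. z e *\<^sub>C e)"
      using \<open>y \<in> cspan E\<close> unfolding complex_vector.span_explicit by blast
    have on: "orthonormal A" using E(1) A(2) by (rule orthonormal_subset)
    have "R y = (\<Sum>e\<in>A. z e *\<^sub>C (\<kappa> e *\<^sub>R e))"
      unfolding y linear_sum[OF bounded_clinearD(2)[OF R]]
      using A eig by (intro sum.cong) (auto simp: bounded_clinearD(3)[OF R])
    then have "R y = (\<Sum>e\<in>A. (z e * of_real (\<kappa> e)) *\<^sub>C e)"
      by (simp add: scaleR_scaleC scaleC_scaleC)
    then have "(norm (R y))\<^sup>2 = (\<Sum>e\<in>A. (cmod (z e * of_real (\<kappa> e)))\<^sup>2)"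
      using norm_orthonormal_combination[OF on A(1)] by simp
    also have "\<dots> \<le> (\<Sum>e\<in>A. c\<^sup>2 * (cmod (z e))\<^sup>2)"
    proof (rule sum_mono)
      fix e assume "e \<in> A"
      then have "\<bar>\<kappa> e\<bar>\<^sup>2 \<le> c\<^sup>2" using eig(2) A by (intro power_mono) auto
      then show "(cmod (z e * of_real (\<kappa> e)))\<^sup>2 \<le> c\<^sup>2 * (cmod (z e))\<^sup>2"
        by (simp add: norm_mult power_mult_distrib mult.commute mult_right_mono)
    qed
    also have "\<dots> = (c * norm y)\<^sup>2"
      unfolding y power_mult_distrib norm_orthonormal_combination[OF on A(1)]
      by (simp add: sum_distrib_left)
    finally show ?thesis by (rule power2_le_imp_le) (simp add: \<open>c \<ge> 0\<close>)
  qed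
  have "closure (cspan E) \<subseteq> {y. norm (R y) \<le> c * norm y}"
  proof (rule closure_minimal)
    show "closed {y. norm (R y) \<le> c * norm y}"
      by (intro closed_Collect_le continuous_intros linear_continuous_on bounded_clinearD(1)[OF R])
  qed (use span in blast)
  then show ?thesis using E(2) by blast
qed

text \<open>Positivity is read off from the norm bound \<open>\<parallel>c x - R x\<parallel> \<le> c \<parallel>x\<parallel>\<close>.\<close>

lemma diagonal_form_nonneg:
  fixes R :: "'a::complex_inner \<Rightarrow> 'a"
  assumes R: "bounded_clinear R" and E: "orthonormal E" "closure (cspan E) = UNIV"
    and eig: "\<And>e. e \<in> E \<Longrightarrow> R e = \<kappa> e *\<^sub>R e" "\<And>e. e \<in> E \<Longrightarrow> 0 \<le> \<kappa> e \<and> \<kappa> e \<le> c" and "c > 0"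
  shows "0 \<le> inner (R x) x"
proof -
  have "norm (c *\<^sub>R x - R x) \<le> c * norm x"
  proof (rule diagonal_norm_le[OF _ E, where \<kappa> = "\<lambda>e. c - \<kappa> e"])
    show "bounded_clinear (\<lambda>x. c *\<^sub>R x - R x)"
      by (intro bounded_clinear_diff bounded_clinear_scaleR R)
    show "c *\<^sub>R e - R e = (c - \<kappa> e) *\<^sub>R e" if "e \<in> E" for e
      using that by (simp add: eig scaleR_diff_left)
    show "\<bar>c - \<kappa> e\<bar> \<le> c" if "e \<in> E" for e using eig(2)[OF that] by simp
  qed (use \<open>c > 0\<close> in simp)
  then have "(norm (c *\<^sub>R x - R x))\<^sup>2 \<le> (c * norm x)\<^sup>2" by (intro power_mono) auto
  then have "inner (R x) (R x) \<le> 2 * (c * inner (R x) x)"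
    unfolding power_mult_distrib power2_norm_eq_inner
    by (simp add: inner_diff_left inner_diff_right inner_commute power2_eq_square algebra_simps)
  then have "0 \<le> c * inner (R x) x" using inner_ge_zero[of "R x"] by linarith
  then show ?thesis using \<open>c > 0\<close> by (simp add: zero_le_mult_iff)
qed

text \<open>For orthonormal \<open>A\<close>, the combination of the rank one projections onto its
  vectors with weights \<open>w\<close>. It serves both as \<open>F\<close> and as the finite
  truncations of \<open>K\<close>.\<close>

definition finite_diagonal ::
    "'a::complex_inner set \<Rightarrow> ('a \<Rightarrow> real) \<Rightarrow> 'a \<Rightarrow> 'a" where
  "finite_diagonal A w x = (\<Sum>e\<in>A. w e *\<^sub>R (cinner x e *\<^sub>C e))"

lemma bounded_clinear_finite_diagonal: "bounded_clinear (finite_diagonal A w)"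
proof -
  have "bounded_linear (\<lambda>x. \<Sum>e\<in>A. w e *\<^sub>R (cinner x e *\<^sub>C e))"
    by (intro bounded_linear_sum bounded_linear_compose[OF bounded_linear_scaleR_right]
        bounded_linear_compose[OF bounded_linear_scaleC_left] bounded_linear_cinner_left)
  moreover have "(\<Sum>e\<in>A. w e *\<^sub>R (cinner (c *\<^sub>C x) e *\<^sub>C e)) = c *\<^sub>C (\<Sum>e\<in>A. w e *\<^sub>R (cinner x e *\<^sub>C e))" for c x
    by (simp add: complex_vector.scale_sum_right scaleC_scaleR_commute cinner_scaleC_left scaleC_scaleC)
  ultimately show ?thesis by (simp add: bounded_clinear_def finite_diagonal_def[abs_def])
qed

lemma finite_diagonal_symmetric: "cinner (finite_diagonal A w x) y = cinner x (finite_diagonal A w y)"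
proof -
  have "cinner (w e *\<^sub>R (cinner x e *\<^sub>C e)) y = cinner x (w e *\<^sub>R (cinner y e *\<^sub>C e))" for e
    using cinner_commute[of e y]
    by (simp add: cinner_scaleR_left cinner_scaleR_right cinner_scaleC_left cinner_scaleC_right)
  then show ?thesis by (simp add: finite_diagonal_def cinner_sum_left cinner_sum_right)
qed

lemma finite_diagonal_positive:
  assumes "\<And>e. e \<in> A \<Longrightarrow> 0 \<le> w e"
  shows "positive_op (finite_diagonal A w)"
proof (rule positive_opI[OF finite_diagonal_symmetric])
  fix x
  have "0 \<le> inner (w e *\<^sub>R (cinner x e *\<^sub>C e)) x" if "e \<in> A" for e
  proof -
    have "inner (cinner x e *\<^sub>C e) x = Re (cinner x e * cnj (cinner x e))"
      using cinner_commute[of e x] by (simp add: Re_cinner[symmetric] cinner_scaleC_left)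
    then show ?thesis using assms[OF that] by (simp add: complex_mult_cnj)
  qed
  then show "0 \<le> inner (finite_diagonal A w x) x"
    by (simp add: finite_diagonal_def inner_sum_left sum_nonneg)
qed

lemma finite_diagonal_apply:
  assumes "orthonormal E" "finite A" "A \<subseteq> E" "f \<in> E"
  shows "finite_diagonal A w f = (if f \<in> A then w f else 0) *\<^sub>R f"
proof -
  have "finite_diagonal A w f = (\<Sum>e\<in>A. if f = e then w e *\<^sub>R e else 0)"
    unfolding finite_diagonal_def
    using assms by (intro sum.cong) (auto simp: orthonormal_cinner[OF assms(1)] scaleC_one subset_iff)
  then show ?thesis using assms(2) by simp
qed

text \<open>\<open>cfinite_dim\<close> asks for equality with a span, not inclusion in one. The
  range is therefore shown to be a subspace, with a basis that is finite as an independent subset of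
  \<open>cspan A\<close>.\<close>

lemma finite_diagonal_finite_rank:
  fixes A :: "'a::complex_inner set"
  assumes "finite A"
  shows "finite_rank_op (finite_diagonal A w)"
proof -
  have bl: "bounded_clinear (finite_diagonal A w)" by (rule bounded_clinear_finite_diagonal)
  have range: "range (finite_diagonal A w) \<subseteq> cspan A"
    by (auto simp: finite_diagonal_def scaleR_scaleC scaleC_scaleC intro!: cspan_sum_mem)
  have csub: "csubspace (range (finite_diagonal A w))"
  proof (rule complex_vector.subspaceI)
    have lin: "linear (finite_diagonal A w)" using bounded_clinearD[OF bl] by blast
    show "0 \<in> range (finite_diagonal A w)" using linear_0[OF lin] by (metis rangeI)
    show "x + y \<in> range (finite_diagonal A w)"
      if xy: "x \<in> range (finite_diagonal A w)" "y \<in> range (finite_diagonal A w)" for x y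
    proof -
      obtain p q where "x = finite_diagonal A w p" "y = finite_diagonal A w q" using xy by blast
      then have "x + y = finite_diagonal A w (p + q)" by (simp add: linear_add[OF lin])
      then show ?thesis by blast
    qed
    show "c *\<^sub>C x \<in> range (finite_diagonal A w)" if x: "x \<in> range (finite_diagonal A w)" for c x
    proof -
      obtain p where "x = finite_diagonal A w p" using x by blast
      then have "c *\<^sub>C x = finite_diagonal A w (c *\<^sub>C p)" by (simp add: bounded_clinearD(3)[OF bl])
      then show ?thesis by blast
    qed
  qed
  obtain B where B: "B \<subseteq> range (finite_diagonal A w)" "complex_vector.independent B"
    "range (finite_diagonal A w) \<subseteq> cspan B"
    using complex_vector.maximal_independent_subset by blast
  have "B \<subseteq> cspan A" using B(1) range by (rule subset_trans)
  then have "finite B" using complex_vector.independent_span_bound[OF assms B(2)] by blast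
  moreover have "cspan B = range (finite_diagonal A w)"
    using B complex_vector.span_minimal[OF B(1) csub] by (intro equalityI)
  ultimately show ?thesis using bl unfolding finite_rank_op_def cfinite_dim_def by blast
qed

text \<open>Total boundedness passes to norm limits: a finite net for the image under
  \<open>G\<close> serves for \<open>K\<close> with a larger radius.\<close>

lemma compact_op_approx:
  fixes K :: "'a::complex_inner \<Rightarrow> 'b::chilbert_space"
  assumes K: "bounded_clinear K"
    and approx: "\<And>\<epsilon>. \<epsilon> > 0 \<Longrightarrow> \<exists>G. compact_op G \<and> (\<forall>x. norm (K x - G x) \<le> \<epsilon> * norm x)"
  shows "compact_op K"
proof -
  have "compact (closure (K ` cball 0 1))"
    unfolding compact_eq_totally_bounded
  proof (intro conjI allI impI)
    show "complete (closure (K ` cball 0 1))" by (simp add: complete_eq_closed)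
    fix \<epsilon> :: real assume "\<epsilon> > 0"
    then obtain G :: "'a \<Rightarrow> 'b" where G: "compact_op G" "\<And>x. norm (K x - G x) \<le> \<epsilon> / 3 * norm x"
      using approx[of "\<epsilon> / 3"] by auto
    have "compact (closure (G ` cball 0 1))" using G(1) by (simp add: compact_op_def)
    moreover have "\<epsilon> / 3 > 0" using \<open>\<epsilon> > 0\<close> by simp
    ultimately obtain k where k: "finite k" "closure (G ` cball 0 1) \<subseteq> (\<Union>y\<in>k. ball y (\<epsilon> / 3))"
      unfolding compact_eq_totally_bounded by blast
    \<comment> \<open>Closed balls let the inclusion survive the closure; radius 2\<epsilon>/3 still
      fits into open balls of radius \<epsilon>.\<close>
    have "K ` cball 0 1 \<subseteq> (\<Union>y\<in>k. cball y (2 * \<epsilon> / 3))"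
    proof (rule image_subsetI)
      fix x :: 'a assume x: "x \<in> cball 0 1"
      have "G x \<in> closure (G ` cball 0 1)" by (rule subsetD[OF closure_subset imageI[OF x]])
      then obtain y where y: "y \<in> k" "dist y (G x) < \<epsilon> / 3" using k(2) by auto
      have "norm (K x - G x) \<le> \<epsilon> / 3 * 1"
        by (rule order_trans[OF G(2) mult_left_mono]) (use x \<open>\<epsilon> > 0\<close> in auto)
      then have "dist y (K x) \<le> 2 * \<epsilon> / 3"
        using y(2) dist_triangle[of y "K x" "G x"] by (simp add: dist_norm norm_minus_commute)
      then show "K x \<in> (\<Union>y\<in>k. cball y (2 * \<epsilon> / 3))" using y(1) by auto
    qed
    then have "closure (K ` cball 0 1) \<subseteq> (\<Union>y\<in>k. cball y (2 * \<epsilon> / 3))"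
      using k(1) by (intro closure_minimal closed_UN) auto
    also have "\<dots> \<subseteq> (\<Union>y\<in>k. ball y \<epsilon>)" using \<open>\<epsilon> > 0\<close> by fastforce
    finally show "\<exists>k. finite k \<and> closure (K ` cball 0 1) \<subseteq> (\<Union>y\<in>k. ball y \<epsilon>)"
      using k(1) by blast
  qed
  then show ?thesis using K by (simp add: compact_op_def)
qed

section \<open>Eigenbasis and construction of the decomposition\<close>

text \<open>By symmetry the orthogonal complement of a maximal orthonormal set of eigenvectors is
  invariant under \<open>T\<close>; were it nonzero, it would contain a further eigenvector.\<close>

lemma abs_min_attaining_eigenbasis:
  fixes T :: "'a::chilbert_space \<Rightarrow> 'a"
  assumes T: "bounded_clinear T" "positive_op T" "abs_min_attaining T"
  obtains E l where "orthonormal E" "\<And>x. \<forall>e\<in>E. cinner x e = 0 \<Longrightarrow> x = 0"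
    "\<And>e. e \<in> E \<Longrightarrow> T e = l e *\<^sub>R e" "\<And>e. e \<in> E \<Longrightarrow> 0 \<le> l e \<and> l e \<le> onorm T"
proof -
  have sym: "cinner (T x) y = cinner x (T y)" for x y using T by (intro positive_op_symmetric)
  obtain E where E: "orthonormal E" "E \<subseteq> {x. \<exists>r. T x = r *\<^sub>R x}"
    and max: "\<And>x. \<lbrakk>x \<in> {x. \<exists>r. T x = r *\<^sub>R x}; norm x = 1; \<forall>e\<in>E. cinner x e = 0\<rbrakk> \<Longrightarrow> False"
    using maximal_orthonormal_subset[of "{x. \<exists>r. T x = r *\<^sub>R x}"] by blast
  have "\<forall>e\<in>E. \<exists>r. T e = r *\<^sub>R e" using E(2) by blast
  then obtain l where l: "\<And>e. e \<in> E \<Longrightarrow> T e = l e *\<^sub>R e" by metis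
  have bounds: "0 \<le> l e \<and> l e \<le> onorm T" if e: "e \<in> E" for e
  proof -
    have n: "norm e = 1" using E(1) e by (rule orthonormal_norm)
    have "inner (T e) e = l e" using n by (simp add: l[OF e] power2_norm_eq_inner[symmetric])
    then have "0 \<le> l e" using positive_op_form_nonneg[OF T(2), of e] by simp
    moreover have "norm (T e) \<le> onorm T * norm e" using bounded_clinearD(1)[OF T(1)] by (rule onorm)
    ultimately show ?thesis by (simp add: l[OF e] n)
  qed
  have "x = 0" if x: "\<forall>e\<in>E. cinner x e = 0" for x
  proof (rule ccontr)
    assume "x \<noteq> 0"
    let ?M = "{z. \<forall>e\<in>E. cinner z e = 0}"
    have "T z \<in> ?M" if "z \<in> ?M" for z
      using that by (simp add: sym l cinner_scaleR_right)
    moreover have "?M \<noteq> {0}" using x \<open>x \<noteq> 0\<close> by blast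
    ultimately obtain z where "z \<in> ?M" "norm z = 1" "\<exists>r. T z = r *\<^sub>R z"
      using abs_min_attaining_eigenvector[OF T(1) sym T(3) csubspace_orthogonal[of E] closed_orthogonal[of E]]
      by blast
    then show False using max[of z] by blast
  qed
  then show ?thesis using that[OF E(1) _ l bounds] by blast
qed

lemma abs_min_attaining_imp_AM_decomposition:
  fixes T :: "'a::chilbert_space \<Rightarrow> 'a"
  assumes inf: "\<not> cfinite_dim (UNIV :: 'a set)"
    and T: "bounded_clinear T" "positive_op T" "abs_min_attaining T"
  shows "\<exists>\<alpha> K F. AM_decomposition T \<alpha> K F"
proof -
  obtain E l where E: "orthonormal E" and total: "\<And>x. \<forall>e\<in>E. cinner x e = 0 \<Longrightarrow> x = 0"
    and l: "\<And>e. e \<in> E \<Longrightarrow> T e = l e *\<^sub>R e" "\<And>e. e \<in> E \<Longrightarrow> 0 \<le> l e \<and> l e \<le> onorm T"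
    using abs_min_attaining_eigenbasis[OF T] by metis
  have dense: "closure (cspan E) = UNIV" using total by (rule total_imp_closure_cspan_UNIV)
  have "infinite E" using E inf total by (rule total_orthonormal_infinite)
  then obtain g \<alpha> where g: "inj g" "\<And>n::nat. g n \<in> E" "(\<lambda>n. l (g n)) \<longlonglongrightarrow> \<alpha>" and \<alpha>: "0 \<le> \<alpha>"
    using infinite_bounded_cluster[of E 0 l "onorm T"] l(2) by metis
  have cluster: "\<beta> = \<alpha>" if h: "inj h" "\<And>n::nat. h n \<in> E" "(\<lambda>n. l (h n)) \<longlonglongrightarrow> \<beta>" for h \<beta>
    using eigenvalue_cluster_le[OF T(1,3) E l(1) _ g h] eigenvalue_cluster_le[OF T(1,3) E l(1) _ h g] l(2)
    by (meson order_antisym)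
  define A where "A = {e\<in>E. \<alpha> < l e}"
  have AE: "A \<subseteq> E" by (auto simp: A_def)
  \<comment> \<open>Infinitely many eigenvectors above \<alpha> would have a cluster value, which is
    \<alpha> by \<open>cluster\<close> and approached strictly from above.\<close>
  have finA: "finite A"
  proof (rule ccontr)
    assume "infinite A"
    moreover have "\<alpha> \<le> l e \<and> l e \<le> onorm T" if "e \<in> A" for e using that l(2) by (auto simp: A_def)
    ultimately obtain h \<beta> where h: "inj h" "\<And>n::nat. h n \<in> A" "(\<lambda>n. l (h n)) \<longlonglongrightarrow> \<beta>"
      using infinite_bounded_cluster[of A \<alpha> l "onorm T"] by metis
    have hE: "h n \<in> E" "\<alpha> < l (h n)" for n using h(2)[of n] by (auto simp: A_def)
    have "\<beta> = \<alpha>" using h(1) hE(1) h(3) by (rule cluster)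
    then show False
      using no_eigenvalue_cluster_from_above[OF T(1,3) E l(1) h(1) hE(1) _ \<alpha> hE(2)] h(3) by blast
  qed
  have fin: "finite {e\<in>E. l e < \<alpha> - \<epsilon>}" if "\<epsilon> > 0" for \<epsilon>
  proof (rule ccontr)
    define B where "B = {e\<in>E. l e < \<alpha> - \<epsilon>}"
    assume "infinite {e\<in>E. l e < \<alpha> - \<epsilon>}"
    then have "infinite B" by (simp add: B_def)
    moreover have "0 \<le> l e \<and> l e \<le> \<alpha> - \<epsilon>" if "e \<in> B" for e using that l(2) by (auto simp: B_def)
    ultimately obtain h \<beta> where h: "inj h" "\<And>n::nat. h n \<in> B" "(\<lambda>n. l (h n)) \<longlonglongrightarrow> \<beta>" "\<beta> \<le> \<alpha> - \<epsilon>"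
      using infinite_bounded_cluster[of B 0 l "\<alpha> - \<epsilon>"] by metis
    have "h n \<in> E" for n using h(2)[of n] by (simp add: B_def)
    then have "\<beta> = \<alpha>" using cluster h(1,3) by blast
    then show False using h(4) \<open>\<epsilon> > 0\<close> by simp
  qed
  \<comment> \<open>\<open>F\<close> carries the excess over \<alpha> on the finite set
    \<open>A\<close>. \<open>K\<close> is solved from the equation, so it inherits boundedness and
    symmetry, and its eigenvalues are \<open>\<kappa>\<close>.\<close>
  define F where "F = finite_diagonal A (\<lambda>e. l e - \<alpha>)"
  define K where "K = (\<lambda>x. \<alpha> *\<^sub>R x - T x + F x)"
  define \<kappa> where "\<kappa> = (\<lambda>e. if e \<in> A then 0 else \<alpha> - l e)"
  have F: "bounded_clinear F" "positive_op F" "finite_rank_op F"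
    using finA by (auto simp: F_def A_def bounded_clinear_finite_diagonal finite_diagonal_finite_rank
        intro!: finite_diagonal_positive)
  have K: "bounded_clinear K"
    unfolding K_def by (intro bounded_clinear_add bounded_clinear_diff bounded_clinear_scaleR T F)
  have K_eig: "K e = \<kappa> e *\<^sub>R e" if "e \<in> E" for e
    using that finite_diagonal_apply[OF E finA AE that]
    by (simp add: K_def F_def \<kappa>_def l(1) scaleR_diff_left)
  have \<kappa>: "0 \<le> \<kappa> e" "\<kappa> e \<le> \<alpha>" if "e \<in> E" for e
    using that l(2) \<alpha> by (auto simp: \<kappa>_def A_def)
  have K_norm: "norm (K x) \<le> \<alpha> * norm x" for x
    using \<kappa> by (intro diagonal_norm_le[OF K E dense K_eig]) (auto simp: \<alpha>)
  have K_sym: "cinner (K x) y = cinner x (K y)" for x y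
    using positive_op_symmetric[OF T(1,2), of x y] finite_diagonal_symmetric[of A _ x y]
    by (simp add: K_def F_def cinner_add_left cinner_add_right cinner_diff_left cinner_diff_right
        cinner_scaleR_left cinner_scaleR_right)
  have K_pos: "positive_op K"
  proof (rule positive_opI[OF K_sym])
    \<comment> \<open>The bound is taken as \<open>\<alpha> + 1\<close> because it has to be
      strictly positive, while \<alpha> may be 0.\<close>
    show "0 \<le> inner (K x) x" for x
      using \<kappa> \<alpha> by (intro diagonal_form_nonneg[OF K E dense K_eig, of "\<alpha> + 1"]) force+
  qed
  have K_compact: "compact_op K"
  proof (rule compact_op_approx[OF K])
    fix \<epsilon> :: real assume "\<epsilon> > 0"
    \<comment> \<open>Removing from \<open>K\<close> its part on the finite set \<open>B\<close>
      leaves eigenvalues of at most \<epsilon>, so the truncation \<open>G\<close> is within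
      \<epsilon> of \<open>K\<close> in norm.\<close>
    define B where "B = {e\<in>E. l e < \<alpha> - \<epsilon>}"
    define G where "G = finite_diagonal B \<kappa>"
    have B: "finite B" "B \<subseteq> E" using fin[OF \<open>\<epsilon> > 0\<close>] by (auto simp: B_def)
    have "norm (K x - G x) \<le> \<epsilon> * norm x" for x
    proof (rule diagonal_norm_le[OF _ E dense, where \<kappa> = "\<lambda>e. if e \<in> B then 0 else \<kappa> e"])
      show "bounded_clinear (\<lambda>x. K x - G x)"
        unfolding G_def by (intro bounded_clinear_diff K bounded_clinear_finite_diagonal)
      show "K e - G e = (if e \<in> B then 0 else \<kappa> e) *\<^sub>R e" if "e \<in> E" for e
        unfolding G_def finite_diagonal_apply[OF E B that] K_eig[OF that] by simp
      show "\<bar>if e \<in> B then 0 else \<kappa> e\<bar> \<le> \<epsilon>" if "e \<in> E" for e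
        using that \<kappa>[OF that] \<open>\<epsilon> > 0\<close> by (auto simp: B_def \<kappa>_def)
    qed (use \<open>\<epsilon> > 0\<close> in simp)
    moreover have "compact_op G"
      unfolding G_def by (intro finite_rank_imp_compact_op finite_diagonal_finite_rank B)
    ultimately show "\<exists>G. compact_op G \<and> (\<forall>x. norm (K x - G x) \<le> \<epsilon> * norm x)" by blast
  qed
  have KA: "K e = 0" if "e \<in> A" for e
    using that AE K_eig[of e] by (auto simp: \<kappa>_def)
  have "K (F x) = 0" for x
    using KA unfolding F_def finite_diagonal_def
    by (simp add: linear_sum[OF bounded_clinearD(2)[OF K]] linear_scale[OF bounded_clinearD(2)[OF K]]
        bounded_clinearD(3)[OF K])
  \<comment> \<open>The coefficients are \<open>cinner (K x) e\<close>, equal to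
    \<open>cinner x (K e)\<close> by symmetry and hence 0 for \<open>e\<close> in
    \<open>A\<close>.\<close>
  moreover have "F (K x) = 0" for x
    using KA unfolding F_def finite_diagonal_def by (simp add: K_sym)
  moreover have "T = (\<lambda>x. \<alpha> *\<^sub>R x - K x + F x)" by (simp add: K_def)
  moreover have "onorm K \<le> \<alpha>" using \<alpha> K_norm by (rule onorm_bound)
  ultimately have "AM_decomposition T \<alpha> K F"
    unfolding AM_decomposition_def using \<alpha> K K_pos K_compact F by (simp add: fun_eq_iff)
  then show ?thesis by blast
qed

theorem theorem5p9:
  fixes T :: "'a::chilbert_space \<Rightarrow> 'a"
  assumes "\<not> cfinite_dim (UNIV :: 'a set)"
    and "bounded_clinear T"
  shows "(T \<in> AM_pos_ops \<longleftrightarrow> (\<exists>\<alpha> K F. AM_decomposition T \<alpha> K F)) \<and>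
    (\<forall>\<alpha> K F \<alpha>' K' F'. AM_decomposition T \<alpha> K F \<and> AM_decomposition T \<alpha>' K' F' \<longrightarrow>
       \<alpha> = \<alpha>' \<and> K = K' \<and> F = F')"
proof (intro conjI iffI allI impI)
  assume "T \<in> AM_pos_ops"
  then show "\<exists>\<alpha> K F. AM_decomposition T \<alpha> K F"
    using abs_min_attaining_imp_AM_decomposition[OF assms(1)]
    by (simp add: AM_pos_ops_def AM_ops_def)
next
  assume "\<exists>\<alpha> K F. AM_decomposition T \<alpha> K F"
  then obtain \<alpha> K F where dec: "AM_decomposition T \<alpha> K F" by blast
  show "T \<in> AM_pos_ops"
    using AM_decomposition_positive[OF dec] AM_decomposition_imp_abs_min_attaining[OF dec] assms(2)
    by (simp add: AM_pos_ops_def AM_ops_def)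
next
  fix \<alpha> K F \<alpha>' K' F'
  assume "AM_decomposition T \<alpha> K F \<and> AM_decomposition T \<alpha>' K' F'"
  then have "\<alpha> = \<alpha>' \<and> K = K' \<and> F = F'"
    using AM_decomposition_unique[OF assms(1)] by blast
  then show "\<alpha> = \<alpha>'" "K = K'" "F = F'" by blast+
qed

end
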